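(* Let $\Gamma$ be a finite set of PDL formulas. If $\Gamma$ is consistent, i.e. there is no closed PDL-tableau for $\Gamma$, then $\Gamma$ is satisfiable.
   Context: PDL syntax: $\phi ::= \bot \mid p \mid \lnot\phi \mid \phi\land\phi \mid [\alpha]\phi$, $\alpha ::= a \mid \tau? \mid \alpha\cup\beta \mid \alpha;\beta \mid \alpha^\ast$ ($a$ atomic programs), with standard Kripke semantics. For a list $\bar\delta=\delta_1\cdots\delta_n$ of programs, $\Box(\bar\delta,\phi)=[\delta_1]\cdots[\delta_n]\phi$ ($=\phi$ if $\bar\delta=\varepsilon$); juxtaposition is concatenation. Unfolding boxes: $\mathit{Tests}(a)=\emptyset$, $\mathit{Tests}(\tau?)=\{\tau\}$, $\mathit{Tests}(\alpha\cup\beta)=\mathit{Tests}(\alpha;\beta)=\mathit{Tests}(\alpha)\cup\mathit{Tests}(\beta)$, $\mathit{Tests}(\alpha^\ast)=\mathit{Tests}(\alpha)$. For a set $\ell$ of formulas: $P^\ell(a)=\{a\}$; $P^\ell(\tau?)=\{\varepsilon\}$ if $\tau\in\ell$, else $\emptyset$; $P^\ell(\beta\cup\gamma)=P^\ell(\beta)\cup P^\ell(\gamma)$; $P^\ell(\beta;\gamma)=\{\bar\beta\gamma\mid\bar\beta\in P^\ell(\beta)\setminus\{\varepsilon\}\}\cup\{\bar\gamma\mid\bar\gamma\in P^\ell(\gamma),\varepsilon\in P^\ell(\beta)\}$; $P^\ell(\beta^\ast)=\{\varepsilon\}\cup\{\bar\beta\beta^\ast\mid\bar\beta\in P^\ell(\beta)\setminus\{\varepsilon\}\}$.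 $F^\ell(\alpha)=\{\lnot\tau\mid\tau\in\mathit{Tests}(\alpha),\tau\notin\ell\}$, $X^\ell_{\alpha,\psi}=F^\ell(\alpha)\cup\{\Box(\bar\alpha,\psi)\mid\bar\alpha\in P^\ell(\alpha)\}$, $\mathsf{unfold}_\Box(\alpha,\psi)=\{X^\ell_{\alpha,\psi}\mid\ell\subseteq\mathit{Tests}(\alpha)\}$. Unfolding diamonds: $H_a=\{(\emptyset,a)\}$, $H_{\tau?}=\{(\{\tau\},\varepsilon)\}$, $H_{\alpha\cup\beta}=H_\alpha\cup H_\beta$, $H_{\alpha;\beta}=\{(X,\bar\delta\beta)\mid(X,\bar\delta)\in H_\alpha,\bar\delta\neq\varepsilon\}\cup\{(X\cup Y,\bar\delta)\mid(X,\varepsilon)\in H_\alpha,(Y,\bar\delta)\in H_\beta\}$, $H_{\alpha^\ast}=\{(\emptyset,\varepsilon)\}\cup\{(X,\bar\delta\alpha^\ast)\mid(X,\bar\delta)\in H_\alpha,\bar\delta\neq\varepsilon\}$; $\mathsf{unfold}_\Diamond(\alpha,\psi)=\{X\cup\{\lnot\Box(\bar\delta,\psi)\}\mid(X,\bar\delta)\in H_\alpha\}$. Loading: each program $\alpha$ has a marked copy $\underline\alpha$ (semantically identical). A loaded formula has the form $\lnot[\underline{\alpha_1}]\cdots[\underline{\alpha_n}]\phi$, $n\ge1$, $\phi$ an unmarked PDL formula; $\xi$ ranges over PDL formulas and expressions $[\underline{\alpha_1}]\cdots[\underline{\alpha_k}]\phi$, $k\ge1$. $\underline\Box(\bar\delta,\xi)=[\underline{\delta_1}]\cdots[\underline{\delta_n}]\xi$,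 $\underline{\mathsf{unfold}}_\Diamond(\alpha,\xi)=\{X\cup\{\lnot\underline\Box(\bar\delta,\xi)\}\mid(X,\bar\delta)\in H_\alpha\}$. A sequent (finite set of possibly loaded formulas) is loaded if it contains a loaded formula, else free; it is basic if all its formulas have the form $\bot,\lnot\bot,p,\lnot p,[a]\phi,\lnot[a]\phi$ ($a$ atomic). $\Delta_a=\{\phi\mid[a]\phi\in\Delta\}$. Rules (principal formula not in context $\Delta$): $(\lnot)$ $\Delta,\lnot\lnot\phi/\Delta,\phi$; $(\land)$ $\Delta,\phi\land\psi/\Delta,\phi,\psi$; $(\lnot\land)$ $\Delta,\lnot(\phi\land\psi)/\Delta,\lnot\phi\mid\Delta,\lnot\psi$; $(\Box)$ $\Delta,[\alpha]\phi/\{\Delta\cup\Gamma\mid\Gamma\in\mathsf{unfold}_\Box(\alpha,\phi)\}$, $\alpha$ non-atomic; $(\Diamond)$ $\Delta,\lnot[\alpha]\phi/\{\Delta\cup\Gamma\mid\Gamma\in\mathsf{unfold}_\Diamond(\alpha,\phi)\}$, $\alpha$ non-atomic; $(\underline\Diamond)$ $\Delta,\lnot[\underline\alpha]\xi/\{\Delta\cup\Gamma\mid\Gamma\in\underline{\mathsf{unfold}}_\Diamond(\alpha,\xi)\}$, $\alpha$ non-atomic; $(L+)$ $\Delta,\lnot[a][\alpha_1]\cdots[\alpha_n]\phi/\Delta,\lnot[\underline a][\underline{\alpha_1}]\cdots[\underline{\alpha_n}]\phi$ with $\Delta$ free and basic, $n\ge0$ maximal; $(L-)$ $\Delta,\lnot[\underline{\alpha_1}]\cdots[\underline{\alpha_n}]\phi/\Delta,\lnot[\alpha_1]\cdots[\alpha_n]\phi$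 with $\Delta$ basic, $n\ge1$; modal rule $(M)$ $\Delta,\lnot[\underline a]\xi/\Delta_a,\lnot\xi$ with $\Delta$ basic. $(L-)$ may not be applied to a node produced by $(L+)$. A tableau is a rooted tree labelled by sequents in which each interior node with its children is a rule instance. A repeat is a node whose label equals that of a proper ancestor (nearest such: its companion); it is a loaded-path repeat if all nodes from companion to it are loaded, a free repeat if it is free. A PDL-tableau is a tableau in which all loaded-path repeats and all free repeats are leaves. A node is closed if its label contains $\bot$ or some $\phi$ and $\lnot\phi$; a PDL-tableau is closed if every leaf is closed or a loaded-path repeat. *)

theory Defs
  imports Main "HOL-Library.Sublist"
begin

section \<open>Syntax\<close>

datatype ('p, 'a) fm =
    Bot
  | Prop 'p
  | Neg "('p, 'a) fm"
  | Conj "('p, 'a) fm" "('p, 'a) fm"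
  | Box "('p, 'a) prog" "('p, 'a) fm"
and ('p, 'a) prog =
    Atomic 'a
  | Test "('p, 'a) fm"
  | Choice "('p, 'a) prog" "('p, 'a) prog"
  | Seq "('p, 'a) prog" "('p, 'a) prog"
  | Star "('p, 'a) prog"

definition is_atomic :: "('p, 'a) prog \<Rightarrow> bool" where
  "is_atomic \<alpha> \<longleftrightarrow> (\<exists>a. \<alpha> = Atomic a)"

definition is_box :: "('p, 'a) fm \<Rightarrow> bool" where
  "is_box \<phi> \<longleftrightarrow> (\<exists>\<alpha> \<psi>. \<phi> = Box \<alpha> \<psi>)"

primrec boxes :: "('p, 'a) prog list \<Rightarrow> ('p, 'a) fm \<Rightarrow> ('p, 'a) fm" where
  "boxes [] \<phi> = \<phi>"
| "boxes (\<delta> # \<delta>s) \<phi> = Box \<delta> (boxes \<delta>s \<phi>)"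


section \<open>Kripke semantics\<close>

record ('w, 'p, 'a) kripke =
  worlds :: "'w set"
  acc :: "'a \<Rightarrow> ('w \<times> 'w) set"
  val :: "'p \<Rightarrow> 'w set"

definition kripke_model :: "('w, 'p, 'a) kripke \<Rightarrow> bool" where
  "kripke_model M \<longleftrightarrow> worlds M \<noteq> {} \<and>
     (\<forall>a. acc M a \<subseteq> worlds M \<times> worlds M) \<and> (\<forall>p. val M p \<subseteq> worlds M)"

fun sat :: "('w, 'p, 'a) kripke \<Rightarrow> 'w \<Rightarrow> ('p, 'a) fm \<Rightarrow> bool"
  and rel :: "('w, 'p, 'a) kripke \<Rightarrow> ('p, 'a) prog \<Rightarrow> ('w \<times> 'w) set" where
  "sat M w Bot \<longleftrightarrow> False"
| "sat M w (Prop p) \<longleftrightarrow> w \<in> val M p"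
| "sat M w (Neg \<phi>) \<longleftrightarrow> \<not> sat M w \<phi>"
| "sat M w (Conj \<phi> \<psi>) \<longleftrightarrow> sat M w \<phi> \<and> sat M w \<psi>"
| "sat M w (Box \<alpha> \<phi>) \<longleftrightarrow> (\<forall>v. (w, v) \<in> rel M \<alpha> \<longrightarrow> sat M v \<phi>)"
| "rel M (Atomic a) = acc M a"
| "rel M (Test \<tau>) = {(w, w) | w. w \<in> worlds M \<and> sat M w \<tau>}"
| "rel M (Choice \<alpha> \<beta>) = rel M \<alpha> \<union> rel M \<beta>"
| "rel M (Seq \<alpha> \<beta>) = rel M \<alpha> O rel M \<beta>"
| "rel M (Star \<alpha>) = {(w, v). w \<in> worlds M \<and> (w, v) \<in> (rel M \<alpha>)\<^sup>*}"

text \<open>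
  HOL cannot quantify over the type of worlds. Models are taken on arbitrary nonempty sets of
  natural numbers, hence on any finite or countable set up to isomorphism; a set of formulas
  satisfiable in this sense is satisfiable in particular.
\<close>

definition satisfiable :: "('p, 'a) fm set \<Rightarrow> bool" where
  "satisfiable \<Gamma> \<longleftrightarrow> (\<exists>(M :: (nat, 'p, 'a) kripke) w.
     kripke_model M \<and> w \<in> worlds M \<and> (\<forall>\<phi>\<in>\<Gamma>. sat M w \<phi>))"


section \<open>Unfolding boxes\<close>

fun Tests :: "('p, 'a) prog \<Rightarrow> ('p, 'a) fm set" where
  "Tests (Atomic a) = {}"
| "Tests (Test \<tau>) = {\<tau>}"
| "Tests (Choice \<alpha> \<beta>) = Tests \<alpha> \<union> Tests \<beta>"
| "Tests (Seq \<alpha> \<beta>) = Tests \<alpha> \<union> Tests \<beta>"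
| "Tests (Star \<alpha>) = Tests \<alpha>"

fun P_box :: "('p, 'a) fm set \<Rightarrow> ('p, 'a) prog \<Rightarrow> ('p, 'a) prog list set" where
  "P_box l (Atomic a) = {[Atomic a]}"
| "P_box l (Test \<tau>) = (if \<tau> \<in> l then {[]} else {})"
| "P_box l (Choice \<beta> \<gamma>) = P_box l \<beta> \<union> P_box l \<gamma>"
| "P_box l (Seq \<beta> \<gamma>) = {bs @ [\<gamma>] | bs. bs \<in> P_box l \<beta> - {[]}} \<union> {cs. cs \<in> P_box l \<gamma> \<and> [] \<in> P_box l \<beta>}"
| "P_box l (Star \<beta>) = {[]} \<union> {bs @ [Star \<beta>] | bs. bs \<in> P_box l \<beta> - {[]}}"

definition F_box :: "('p, 'a) fm set \<Rightarrow> ('p, 'a) prog \<Rightarrow> ('p, 'a) fm set" where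
  "F_box l \<alpha> = {Neg \<tau> | \<tau>. \<tau> \<in> Tests \<alpha> \<and> \<tau> \<notin> l}"

definition X_box :: "('p, 'a) fm set \<Rightarrow> ('p, 'a) prog \<Rightarrow> ('p, 'a) fm \<Rightarrow> ('p, 'a) fm set" where
  "X_box l \<alpha> \<psi> = F_box l \<alpha> \<union> {boxes as \<psi> | as. as \<in> P_box l \<alpha>}"

definition unfold_box :: "('p, 'a) prog \<Rightarrow> ('p, 'a) fm \<Rightarrow> ('p, 'a) fm set set" where
  "unfold_box \<alpha> \<psi> = {X_box l \<alpha> \<psi> | l. l \<subseteq> Tests \<alpha>}"


section \<open>Unfolding diamonds\<close>

fun H_dia :: "('p, 'a) prog \<Rightarrow> (('p, 'a) fm set \<times> ('p, 'a) prog list) set" where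
  "H_dia (Atomic a) = {({}, [Atomic a])}"
| "H_dia (Test \<tau>) = {({\<tau>}, [])}"
| "H_dia (Choice \<alpha> \<beta>) = H_dia \<alpha> \<union> H_dia \<beta>"
| "H_dia (Seq \<alpha> \<beta>) = {(Y, ds @ [\<beta>]) | Y ds. (Y, ds) \<in> H_dia \<alpha> \<and> ds \<noteq> []}
     \<union> {(Y \<union> Z, ds) | Y Z ds. (Y, []) \<in> H_dia \<alpha> \<and> (Z, ds) \<in> H_dia \<beta>}"
| "H_dia (Star \<alpha>) = {({}, [])} \<union> {(Y, ds @ [Star \<alpha>]) | Y ds. (Y, ds) \<in> H_dia \<alpha> \<and> ds \<noteq> []}"

definition unfold_dia :: "('p, 'a) prog \<Rightarrow> ('p, 'a) fm \<Rightarrow> ('p, 'a) fm set set" where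
  "unfold_dia \<alpha> \<psi> = {Y \<union> {Neg (boxes ds \<psi>)} | Y ds. (Y, ds) \<in> H_dia \<alpha>}"


section \<open>Loading\<close>

text \<open>
  In \<open>xi\<close>, the constructor \<open>LBox\<close> is a box with a marked program, so \<open>xi\<close> is the type of PDL
  formulas and of expressions consisting of at least one marked box in front of a PDL formula.
  The elements of sequents have type \<open>sfm\<close>: unmarked formulas \<open>Free \<phi>\<close>, and loaded
  formulas \<open>NegLBox \<alpha> \<xi>\<close>, standing for the negation of \<open>LBox \<alpha> \<xi>\<close>.
\<close>

datatype ('p, 'a) xi =
    Unmarked "('p, 'a) fm"
  | LBox "('p, 'a) prog" "('p, 'a) xi"

datatype ('p, 'a) sfm =
    Free "('p, 'a) fm"
  | NegLBox "('p, 'a) prog" "('p, 'a) xi"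

primrec neg_xi :: "('p, 'a) xi \<Rightarrow> ('p, 'a) sfm" where
  "neg_xi (Unmarked \<phi>) = Free (Neg \<phi>)"
| "neg_xi (LBox \<alpha> \<xi>) = NegLBox \<alpha> \<xi>"

primrec lboxes :: "('p, 'a) prog list \<Rightarrow> ('p, 'a) xi \<Rightarrow> ('p, 'a) xi" where
  "lboxes [] \<xi> = \<xi>"
| "lboxes (\<delta> # \<delta>s) \<xi> = LBox \<delta> (lboxes \<delta>s \<xi>)"

definition lunfold_dia :: "('p, 'a) prog \<Rightarrow> ('p, 'a) xi \<Rightarrow> ('p, 'a) sfm set set" where
  "lunfold_dia \<alpha> \<xi> = {Free ` Y \<union> {neg_xi (lboxes ds \<xi>)} | Y ds. (Y, ds) \<in> H_dia \<alpha>}"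


section \<open>Sequents and rules\<close>

type_synonym ('p, 'a) seqt = "('p, 'a) sfm set"

definition loaded :: "('p, 'a) seqt \<Rightarrow> bool" where
  "loaded \<Delta> \<longleftrightarrow> (\<exists>\<alpha> \<xi>. NegLBox \<alpha> \<xi> \<in> \<Delta>)"

definition basic_fm :: "('p, 'a) fm \<Rightarrow> bool" where
  "basic_fm \<phi> \<longleftrightarrow> \<phi> = Bot \<or> \<phi> = Neg Bot \<or> (\<exists>p. \<phi> = Prop p) \<or> (\<exists>p. \<phi> = Neg (Prop p)) \<or>
     (\<exists>a \<psi>. \<phi> = Box (Atomic a) \<psi>) \<or> (\<exists>a \<psi>. \<phi> = Neg (Box (Atomic a) \<psi>))"

definition basic :: "('p, 'a) seqt \<Rightarrow> bool" where
  "basic \<Delta> \<longleftrightarrow> (\<forall>\<theta>\<in>\<Delta>. \<exists>\<phi>. \<theta> = Free \<phi> \<and> basic_fm \<phi>)"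

definition proj :: "'a \<Rightarrow> ('p, 'a) seqt \<Rightarrow> ('p, 'a) seqt" where
  "proj a \<Delta> = {Free \<phi> | \<phi>. Free (Box (Atomic a) \<phi>) \<in> \<Delta>}"

definition closed_seqt :: "('p, 'a) seqt \<Rightarrow> bool" where
  "closed_seqt \<Delta> \<longleftrightarrow> Free Bot \<in> \<Delta> \<or> (\<exists>\<phi>. Free \<phi> \<in> \<Delta> \<and> Free (Neg \<phi>) \<in> \<Delta>)"

datatype rule = RNeg | RConj | RNegConj | RBox | RDia | RLDia | RLPlus | RLMinus | RModal

text \<open>
  \<open>rule_inst r \<Sigma> \<C>\<close>: an instance of rule \<open>r\<close> leads from a node labelled \<open>\<Sigma>\<close> to
  children whose labels are the elements of \<open>\<C>\<close>.
\<close>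

inductive rule_inst :: "rule \<Rightarrow> ('p, 'a) seqt \<Rightarrow> ('p, 'a) seqt set \<Rightarrow> bool" where
  neg: "Free (Neg (Neg \<phi>)) \<notin> \<Delta> \<Longrightarrow>
    rule_inst RNeg (insert (Free (Neg (Neg \<phi>))) \<Delta>) {insert (Free \<phi>) \<Delta>}"
| conj: "Free (Conj \<phi> \<psi>) \<notin> \<Delta> \<Longrightarrow>
    rule_inst RConj (insert (Free (Conj \<phi> \<psi>)) \<Delta>) {insert (Free \<phi>) (insert (Free \<psi>) \<Delta>)}"
| neg_conj: "Free (Neg (Conj \<phi> \<psi>)) \<notin> \<Delta> \<Longrightarrow>
    rule_inst RNegConj (insert (Free (Neg (Conj \<phi> \<psi>))) \<Delta>)
      {insert (Free (Neg \<phi>)) \<Delta>, insert (Free (Neg \<psi>)) \<Delta>}"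
| box: "Free (Box \<alpha> \<phi>) \<notin> \<Delta> \<Longrightarrow> \<not> is_atomic \<alpha> \<Longrightarrow>
    rule_inst RBox (insert (Free (Box \<alpha> \<phi>)) \<Delta>) {\<Delta> \<union> Free ` \<Gamma> | \<Gamma>. \<Gamma> \<in> unfold_box \<alpha> \<phi>}"
| dia: "Free (Neg (Box \<alpha> \<phi>)) \<notin> \<Delta> \<Longrightarrow> \<not> is_atomic \<alpha> \<Longrightarrow>
    rule_inst RDia (insert (Free (Neg (Box \<alpha> \<phi>))) \<Delta>) {\<Delta> \<union> Free ` \<Gamma> | \<Gamma>. \<Gamma> \<in> unfold_dia \<alpha> \<phi>}"
| ldia: "NegLBox \<alpha> \<xi> \<notin> \<Delta> \<Longrightarrow> \<not> is_atomic \<alpha> \<Longrightarrow>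
    rule_inst RLDia (insert (NegLBox \<alpha> \<xi>) \<Delta>) {\<Delta> \<union> \<Gamma> | \<Gamma>. \<Gamma> \<in> lunfold_dia \<alpha> \<xi>}"
| lplus: "Free (Neg (Box (Atomic a) (boxes \<alpha>s \<phi>))) \<notin> \<Delta> \<Longrightarrow> \<not> loaded \<Delta> \<Longrightarrow> basic \<Delta> \<Longrightarrow> \<not> is_box \<phi> \<Longrightarrow>
    rule_inst RLPlus (insert (Free (Neg (Box (Atomic a) (boxes \<alpha>s \<phi>)))) \<Delta>)
      {insert (NegLBox (Atomic a) (lboxes \<alpha>s (Unmarked \<phi>))) \<Delta>}"
| lminus: "NegLBox \<alpha> (lboxes \<alpha>s (Unmarked \<phi>)) \<notin> \<Delta> \<Longrightarrow> basic \<Delta> \<Longrightarrow>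
    rule_inst RLMinus (insert (NegLBox \<alpha> (lboxes \<alpha>s (Unmarked \<phi>))) \<Delta>)
      {insert (Free (Neg (Box \<alpha> (boxes \<alpha>s \<phi>)))) \<Delta>}"
| modal: "NegLBox (Atomic a) \<xi> \<notin> \<Delta> \<Longrightarrow> basic \<Delta> \<Longrightarrow>
    rule_inst RModal (insert (NegLBox (Atomic a) \<xi>) \<Delta>) {insert (neg_xi \<xi>) (proj a \<Delta>)}"


section \<open>Tableaux\<close>

text \<open>
  The nodes of a tree, possibly infinite, are the elements of a prefix-closed set of lists of
  natural numbers: the root is \<open>[]\<close>, and the children of \<open>u\<close> are the nodes \<open>u @ [i]\<close>.
  The field \<open>rul\<close> records the rule applied at an interior node; its value at leaves is
  irrelevant.
\<close>

record ('p, 'a) tab =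
  nodes :: "nat list set"
  lab :: "nat list \<Rightarrow> ('p, 'a) seqt"
  rul :: "nat list \<Rightarrow> rule"

definition children :: "('p, 'a) tab \<Rightarrow> nat list \<Rightarrow> nat list set" where
  "children t u = {v \<in> nodes t. \<exists>i. v = u @ [i]}"

definition leaf :: "('p, 'a) tab \<Rightarrow> nat list \<Rightarrow> bool" where
  "leaf t u \<longleftrightarrow> u \<in> nodes t \<and> children t u = {}"

definition interior :: "('p, 'a) tab \<Rightarrow> nat list \<Rightarrow> bool" where
  "interior t u \<longleftrightarrow> u \<in> nodes t \<and> children t u \<noteq> {}"

definition tableau :: "('p, 'a) tab \<Rightarrow> bool" where
  "tableau t \<longleftrightarrow>
     [] \<in> nodes t \<and>
     (\<forall>u v. v \<in> nodes t \<and> prefix u v \<longrightarrow> u \<in> nodes t) \<and>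
     (\<forall>u\<in>nodes t. finite (lab t u)) \<and>
     (\<forall>u. interior t u \<longrightarrow>
        finite (children t u) \<and> rule_inst (rul t u) (lab t u) (lab t ` children t u)) \<and>
     (\<forall>u v. interior t u \<and> v \<in> children t u \<and> interior t v \<and> rul t u = RLPlus \<longrightarrow>
        rul t v \<noteq> RLMinus)"

definition repeat :: "('p, 'a) tab \<Rightarrow> nat list \<Rightarrow> bool" where
  "repeat t v \<longleftrightarrow> v \<in> nodes t \<and> (\<exists>u. strict_prefix u v \<and> lab t u = lab t v)"

definition companion :: "('p, 'a) tab \<Rightarrow> nat list \<Rightarrow> nat list \<Rightarrow> bool" where
  "companion t u v \<longleftrightarrow> v \<in> nodes t \<and> strict_prefix u v \<and> lab t u = lab t v \<and>
     (\<forall>w. strict_prefix u w \<and> strict_prefix w v \<longrightarrow> lab t w \<noteq> lab t v)"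

definition loaded_path_repeat :: "('p, 'a) tab \<Rightarrow> nat list \<Rightarrow> bool" where
  "loaded_path_repeat t v \<longleftrightarrow> repeat t v \<and>
     (\<exists>u. companion t u v \<and> (\<forall>w. prefix u w \<and> prefix w v \<longrightarrow> loaded (lab t w)))"

definition free_repeat :: "('p, 'a) tab \<Rightarrow> nat list \<Rightarrow> bool" where
  "free_repeat t v \<longleftrightarrow> repeat t v \<and> \<not> loaded (lab t v)"

definition PDL_tableau :: "('p, 'a) tab \<Rightarrow> bool" where
  "PDL_tableau t \<longleftrightarrow> tableau t \<and>
     (\<forall>v. loaded_path_repeat t v \<or> free_repeat t v \<longrightarrow> leaf t v)"

definition closed_PDL_tableau :: "('p, 'a) tab \<Rightarrow> bool" where
  "closed_PDL_tableau t \<longleftrightarrow> PDL_tableau t \<and>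
     (\<forall>v. leaf t v \<longrightarrow> closed_seqt (lab t v) \<or> loaded_path_repeat t v)"

definition consistent :: "('p, 'a) fm set \<Rightarrow> bool" where
  "consistent \<Gamma> \<longleftrightarrow> \<not> (\<exists>t. closed_PDL_tableau t \<and> lab t [] = Free ` \<Gamma>)"

end

theory Submission imports Defs begin

text \<open>
  Read a tableau as a game: Prover picks rules, Builder picks children. The game is determined, so
  if there is no closed tableau for \<open>\<Gamma>\<close>, then Builder can survive against any choice of rules.
  The worlds of the model are the free basic sequents, over a finite Fischer-Ladner closure, from
  which Builder survives. A world \<open>w\<close> sees \<open>v\<close> along \<open>a\<close> if \<open>v\<close> locally entails every \<open>\<phi>\<close> with
  \<open>[a]\<phi>\<close> in \<open>w\<close>, that is, \<open>v\<close> contains all basic formulas on some branch of the local expansion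
  of \<open>\<phi>\<close>. To realise a diamond in \<open>w\<close>, let Prover load it with \<open>(L+)\<close> and then apply only \<open>(M)\<close> and
  local rules. Builder survives only if no label repeats, so the play reaches a sequent in which
  the diamond has been fulfilled; and since Prover could have applied \<open>(L-)\<close> at each basic loaded
  sequent on the way, unloading these sequents gives worlds that form the required path.
\<close>

section \<open>The tableau game\<close>

text \<open>
  Here \<open>h\<close> collects the labels of the loaded nodes that precede the current node since the
  last free node. A loaded node with \<open>h = {}\<close> has just been produced by \<open>(L+)\<close>; this is how
  the restriction on \<open>(L-)\<close> is expressed. The number bounds the height of the refutation.
\<close>

definition hist :: "('p, 'a) seqt set \<Rightarrow> ('p, 'a) seqt \<Rightarrow> ('p, 'a) seqt \<Rightarrow> ('p, 'a) seqt set" where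
  "hist h \<Sigma> c = (if loaded \<Sigma> \<and> loaded c then insert \<Sigma> h else {})"

inductive refut :: "nat \<Rightarrow> ('p, 'a) seqt set \<Rightarrow> ('p, 'a) seqt \<Rightarrow> bool" where
  closed: "closed_seqt \<Sigma> \<Longrightarrow> refut n h \<Sigma>"
| repeated: "\<Sigma> \<in> h \<Longrightarrow> refut n h \<Sigma>"
| step: "rule_inst r \<Sigma> C \<Longrightarrow> (r = RLMinus \<Longrightarrow> h \<noteq> {}) \<Longrightarrow> finite C \<Longrightarrow> C \<noteq> {} \<Longrightarrow>
    (\<And>c. c \<in> C \<Longrightarrow> finite c) \<Longrightarrow> (\<And>c. c \<in> C \<Longrightarrow> refut n (hist h \<Sigma> c) c) \<Longrightarrow> refut (Suc n) h \<Sigma>"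

lemma refut_Suc: "refut n h \<Sigma> \<Longrightarrow> refut (Suc n) h \<Sigma>"
proof (induction rule: refut.induct)
  case (step r \<Sigma> C h n)
  show ?case
    by (rule refut.step[OF step(1) step(2) step(3,4) step(5) step(7)])
qed (auto intro: refut.intros)

lemma refut_mono: "refut n h \<Sigma> \<Longrightarrow> n \<le> m \<Longrightarrow> refut m h \<Sigma>"
  by (induction m) (auto simp: le_Suc_eq intro: refut_Suc)

section \<open>From refutations to closed tableaux\<close>

type_synonym ('p, 'a) state = "('p, 'a) seqt set \<times> ('p, 'a) seqt"

text \<open>
  Prover plays a positional strategy that always moves to smaller rank. As \<open>h = {}\<close> at free nodes,
  a free repeat would have the rank of its companion; hence there are none.
\<close>

definition rank :: "('p, 'a) state \<Rightarrow> nat" where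
  "rank s = (LEAST n. refut n (fst s) (snd s))"

text \<open>The children form a list because nodes of the tableau are addressed by child indices.
  The strict bound makes every move lower \<open>rank\<close>.\<close>

definition good_move :: "('p, 'a) state \<Rightarrow> rule \<times> ('p, 'a) seqt list \<Rightarrow> bool" where
  "good_move s m \<longleftrightarrow> rule_inst (fst m) (snd s) (set (snd m)) \<and>
     (fst m = RLMinus \<longrightarrow> fst s \<noteq> {}) \<and> snd m \<noteq> [] \<and>
     (\<forall>c\<in>set (snd m). finite c \<and> (\<exists>n<rank s. refut n (hist (fst s) (snd s) c) c))"

definition strat :: "('p, 'a) state \<Rightarrow> rule \<times> ('p, 'a) seqt list" where
  "strat s = (SOME m. good_move s m)"

lemma good_move_strat:
  assumes "refut n h \<Sigma>" "\<not> closed_seqt \<Sigma>" "\<Sigma> \<notin> h"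
  shows "good_move (h, \<Sigma>) (strat (h, \<Sigma>))"
proof -
  have "refut (rank (h, \<Sigma>)) h \<Sigma>"
    unfolding rank_def using assms(1) by (auto intro: LeastI)
  then have "\<exists>m. good_move (h, \<Sigma>) m"
  proof cases
    case (step r C n)
    from \<open>finite C\<close> obtain cs where cs: "set cs = C" using finite_list by blast
    have "good_move (h, \<Sigma>) (r, cs)"
      unfolding good_move_def using step cs by auto
    then show ?thesis ..
  qed (use assms in auto)
  then show ?thesis unfolding strat_def by (rule someI_ex)
qed

text \<open>Play stops exactly where a closed tableau may have a leaf: at closed labels and at
  labels already in the history.\<close>

definition kids :: "('p, 'a) state \<Rightarrow> ('p, 'a) state list" where
  "kids s = (if closed_seqt (snd s) \<or> snd s \<in> fst s then []
     else map (\<lambda>c. (hist (fst s) (snd s) c, c)) (snd (strat s)))"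

definition run :: "('p, 'a) state \<Rightarrow> nat list \<Rightarrow> ('p, 'a) state" where
  "run = foldl (\<lambda>s i. kids s ! i)"

text \<open>\<open>run\<close> is total, but its value means nothing once an index is out of range.
  The addresses accepted by \<open>path\<close> become the nodes of the tableau.\<close>

primrec path :: "('p, 'a) state \<Rightarrow> nat list \<Rightarrow> bool" where
  "path s [] \<longleftrightarrow> True"
| "path s (i # u) \<longleftrightarrow> i < length (kids s) \<and> path (kids s ! i) u"

lemma run_simps [simp]: "run s [] = s" "run s (i # u) = run (kids s ! i) u"
    "run s (u @ v) = run (run s u) v"
  by (auto simp: run_def)

lemma path_append [simp]: "path s (u @ v) \<longleftrightarrow> path s u \<and> path (run s u) v"
  by (induction u arbitrary: s) auto

text \<open>The last conjunct is the invariant by which a free state is determined by its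
  label.\<close>

definition winning :: "('p, 'a) state \<Rightarrow> bool" where
  "winning s \<longleftrightarrow> (\<exists>n. refut n (fst s) (snd s)) \<and> finite (snd s) \<and> (\<not> loaded (snd s) \<longrightarrow> fst s = {})"

lemma winning_kid:
  assumes "winning s" "s' \<in> set (kids s)"
  shows "winning s' \<and> rank s' < rank s"
proof -
  obtain h \<Sigma> where s: "s = (h, \<Sigma>)" by fastforce
  have nc: "\<not> closed_seqt \<Sigma>" "\<Sigma> \<notin> h" using assms(2) by (auto simp: kids_def s split: if_splits)
  obtain c where c: "c \<in> set (snd (strat s))" "s' = (hist h \<Sigma> c, c)"
    using assms(2) by (auto simp: kids_def s split: if_splits)
  obtain k where "refut k h \<Sigma>" using assms(1) by (auto simp: winning_def s)
  then have "good_move s (strat s)" using good_move_strat nc s by blast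
  then obtain n where n: "finite c" "n < rank s" "refut n (hist h \<Sigma> c) c"
    using c(1) by (auto simp: good_move_def s)
  have "rank s' \<le> n" unfolding rank_def c(2) using n(3) by (auto intro: Least_le)
  then show ?thesis using n c(2) by (auto simp: winning_def hist_def)
qed

lemma winning_run: "winning s \<Longrightarrow> path s u \<Longrightarrow> winning (run s u) \<and> rank (run s u) + length u \<le> rank s"
proof (induction u arbitrary: s)
  case (Cons i u)
  have "winning (kids s ! i) \<and> rank (kids s ! i) < rank s"
    using winning_kid Cons.prems by (metis nth_mem path.simps(2))
  then show ?case using Cons by fastforce
qed simp

text \<open>The bridge from the game to \<open>loaded_path_repeat\<close>: the history, computed
  move by move, amounts to a condition on the branch. It is extended while labels stay loaded and
  emptied as soon as one end of an edge is free.\<close>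

lemma fst_run:
  assumes "fst s = {}" "path s u"
  shows "\<Theta> \<in> fst (run s u) \<longleftrightarrow> (\<exists>v. strict_prefix v u \<and> snd (run s v) = \<Theta> \<and>
    (\<forall>w. prefix v w \<and> prefix w u \<longrightarrow> loaded (snd (run s w))))"
  using assms(2)
proof (induction u rule: rev_induct)
  case Nil
  then show ?case using assms(1) by simp
next
  case (snoc i u)
  let ?s = "run s u" and ?s' = "run s (u @ [i])"
  have i: "i < length (kids ?s)" using snoc.prems by simp
  then have s': "fst ?s' = hist (fst ?s) (snd ?s) (snd ?s')"
    by (auto simp: kids_def split: if_splits)
  have IH: "\<Theta> \<in> fst ?s \<longleftrightarrow> (\<exists>v. strict_prefix v u \<and> snd (run s v) = \<Theta> \<and>
    (\<forall>w. prefix v w \<and> prefix w u \<longrightarrow> loaded (snd (run s w))))"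
    using snoc by simp
  have sp: "strict_prefix v (u @ [i]) \<longleftrightarrow> prefix v u" for v
    by (auto simp: strict_prefix_def prefix_def append_eq_append_conv2 Cons_eq_append_conv)
  show ?case
  proof (cases "loaded (snd ?s) \<and> loaded (snd ?s')")
    case True
    then have "\<Theta> \<in> fst ?s' \<longleftrightarrow> \<Theta> = snd ?s \<or> \<Theta> \<in> fst ?s"
      by (simp only: s' hist_def) auto
    also have "\<dots> \<longleftrightarrow> (\<exists>v. prefix v u \<and> snd (run s v) = \<Theta> \<and>
      (\<forall>w. prefix v w \<and> prefix w u \<longrightarrow> loaded (snd (run s w))))" (is "_ \<longleftrightarrow> ?R")
    proof
      assume "\<Theta> = snd ?s \<or> \<Theta> \<in> fst ?s"
      then show ?R
      proof
        assume "\<Theta> = snd ?s"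
        then show ?R using True by (intro exI[of _ u]) (auto dest: prefix_order.antisym)
      next
        assume "\<Theta> \<in> fst ?s" then show ?R unfolding IH by (auto simp: strict_prefix_def)
      qed
    next
      assume ?R then show "\<Theta> = snd ?s \<or> \<Theta> \<in> fst ?s"
        unfolding IH by (auto simp: strict_prefix_def)
    qed
    also have "\<dots> \<longleftrightarrow> (\<exists>v. strict_prefix v (u @ [i]) \<and> snd (run s v) = \<Theta> \<and>
      (\<forall>w. prefix v w \<and> prefix w (u @ [i]) \<longrightarrow> loaded (snd (run s w))))"
      unfolding sp prefix_snoc using True by blast
    finally show ?thesis .
  next
    case False
    then have "fst ?s' = {}" by (simp only: s' hist_def) auto
    \<comment> \<open>For every prefix \<open>v\<close> of \<open>u\<close>, both \<open>u\<close>
      and \<open>u @ [i]\<close> lie on the segment from \<open>v\<close>, and one of them is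
      free.\<close>
    moreover have "\<not> (\<exists>v. prefix v u \<and> (\<forall>w. prefix v w \<and> prefix w (u @ [i]) \<longrightarrow> loaded (snd (run s w))))"
      using False by (metis prefix_order.refl prefix_snoc prefixI prefix_prefix)
    ultimately show ?thesis unfolding sp by blast
  qed
qed

text \<open>Take the longest strict prefix with the same label. It extends \<open>u\<close>, so if
  all nodes from \<open>u\<close> on are loaded, so are all nodes from the companion on.\<close>

lemma repeat_has_companion:
  assumes v: "v \<in> nodes t" and u: "strict_prefix u v" "lab t u = lab t v"
  obtains u' where "companion t u' v" "prefix u u'"
proof -
  let ?Q = "\<lambda>x. strict_prefix x v \<and> lab t x = lab t v"
  have "\<forall>y. ?Q y \<longrightarrow> length y < length v" by (auto dest: prefix_length_less)
  then obtain u' where u': "?Q u'" "\<forall>y. ?Q y \<longrightarrow> length y \<le> length u'"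
    using ex_has_greatest_nat[of ?Q u length "length v"] u by blast
  have "companion t u' v"
    unfolding companion_def using u' v by (metis prefix_length_less not_le)
  moreover have "prefix u u'"
    using u u' by (metis prefix_length_prefix prefix_order.less_imp_le)
  ultimately show thesis by (rule that)
qed

text \<open>The tableau is the tree of all plays against \<open>strat\<close>: interior nodes are
  rule instances by \<open>good_move_strat\<close>, and leaves are the states where play
  stops.\<close>

lemma refut_closed_tableau:
  assumes "refut n {} \<Sigma>" "finite \<Sigma>" "\<not> loaded \<Sigma>"
  shows "\<exists>t. closed_PDL_tableau t \<and> lab t [] = \<Sigma>"
proof -
  define s where "s = ({} :: ('a, 'b) seqt set, \<Sigma>)"
  define t where "t = \<lparr>nodes = {u. path s u}, lab = \<lambda>u. snd (run s u), rul = \<lambda>u. fst (strat (run s u))\<rparr>"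
  have t [simp]: "nodes t = {u. path s u}" "lab t = (\<lambda>u. snd (run s u))" "rul t = (\<lambda>u. fst (strat (run s u)))"
    by (auto simp: t_def)
  have win: "winning s" using assms by (auto simp: s_def winning_def)
  have fs: "fst s = {}" by (simp add: s_def)
  have ch: "children t u = {u @ [i] | i. i < length (kids (run s u))}" if "path s u" for u
    using that by (auto simp: children_def)
  have good: "good_move (run s u) (strat (run s u))" if "path s u" "kids (run s u) \<noteq> []" for u
  proof -
    have "winning (run s u)" using winning_run[OF win that(1)] ..
    then obtain k where "refut k (fst (run s u)) (snd (run s u))" by (auto simp: winning_def)
    then show ?thesis
      using good_move_strat[of k "fst (run s u)" "snd (run s u)"] that(2)
      by (auto simp: kids_def split: if_splits)
  qed
  have interior: "interior t u \<longleftrightarrow> path s u \<and> kids (run s u) \<noteq> []" for u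
    using ch[of u] by (auto simp: interior_def)
  have lab_kids: "snd ` set (kids (run s u)) = set (snd (strat (run s u)))" if "kids (run s u) \<noteq> []" for u
    using that by (auto simp: kids_def image_image split: if_splits)
  have tab: "tableau t"
    unfolding tableau_def
  proof (intro conjI allI impI ballI)
    show "[] \<in> nodes t" by simp
  next
    fix u v assume "v \<in> nodes t \<and> prefix u v" then show "u \<in> nodes t" by (auto simp: prefix_def)
  next
    fix u assume "u \<in> nodes t" then show "finite (lab t u)" using winning_run[OF win] by (auto simp: winning_def)
  next
    fix u assume "interior t u"
    then have u: "path s u" "kids (run s u) \<noteq> []" using interior by auto
    show "finite (children t u)" using ch[OF u(1)] by simp
    have "lab t ` children t u = snd ` set (kids (run s u))"
      unfolding ch[OF u(1)] set_conv_nth by (simp add: setcompr_eq_image image_image)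
    then show "rule_inst (rul t u) (lab t u) (lab t ` children t u)"
      using good[OF u] lab_kids[OF u(2)] by (simp add: good_move_def)
  next
    fix u v assume uv: "interior t u \<and> v \<in> children t u \<and> interior t v \<and> rul t u = RLPlus"
    then have u: "path s u" "kids (run s u) \<noteq> []" and v: "path s v" "kids (run s v) \<noteq> []"
      using interior by auto
    obtain i where i: "v = u @ [i]" "i < length (kids (run s u))" using uv ch u by auto
    have "rule_inst RLPlus (snd (run s u)) (set (snd (strat (run s u))))"
      using good[OF u] uv by (simp add: good_move_def)
    \<comment> \<open>(L+) is applied to a free sequent, so the history at its child is empty,
      whereas \<open>good_move\<close> allows (L-) only with a nonempty history.\<close>
    then have "\<not> loaded (snd (run s u))" by cases (auto simp: loaded_def)
    then have "fst (run s v) = {}"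
      using i by (auto simp: kids_def hist_def split: if_splits)
    then show "rul t v \<noteq> RLMinus" using good[OF v] by (auto simp: good_move_def)
  qed
  have lpr: "loaded_path_repeat t v \<longleftrightarrow> snd (run s v) \<in> fst (run s v)" if v: "path s v" for v
  proof
    assume "loaded_path_repeat t v"
    then obtain u where "companion t u v" "\<forall>w. prefix u w \<and> prefix w v \<longrightarrow> loaded (lab t w)"
      by (auto simp: loaded_path_repeat_def)
    then show "snd (run s v) \<in> fst (run s v)"
      unfolding fst_run[OF fs v] by (auto simp: companion_def)
  next
    assume "snd (run s v) \<in> fst (run s v)"
    then obtain u where u: "strict_prefix u v" "lab t u = lab t v"
      "\<forall>w. prefix u w \<and> prefix w v \<longrightarrow> loaded (lab t w)"
      unfolding fst_run[OF fs v] by auto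
    have vn: "v \<in> nodes t" using v by simp
    from repeat_has_companion[OF vn u(1,2)] obtain u' where "companion t u' v" "prefix u u'" .
    then show "loaded_path_repeat t v"
      using u vn unfolding loaded_path_repeat_def repeat_def by (meson prefix_order.trans)
  qed
  have nofree: "\<not> free_repeat t v" for v
  proof
    assume "free_repeat t v"
    then obtain u where v: "path s v" "\<not> loaded (snd (run s v))" "strict_prefix u v" "snd (run s u) = snd (run s v)"
      by (auto simp: free_repeat_def repeat_def)
    then obtain x where x: "v = u @ x" "x \<noteq> []" by (auto simp: strict_prefix_def prefix_def)
    then have p: "path s u" "path (run s u) x" using v by auto
    have wu: "winning (run s u)" and wv: "winning (run s v)" using winning_run[OF win] p v by auto
    then have "run s u = run s v" using v by (auto simp: winning_def prod_eq_iff)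
    moreover have "rank (run s v) + length x \<le> rank (run s u)"
      using winning_run[OF wu p(2)] x by simp
    ultimately show False using x by simp
  qed
  have "PDL_tableau t"
    unfolding PDL_tableau_def
  proof (intro conjI allI impI tab)
    fix v assume "loaded_path_repeat t v \<or> free_repeat t v"
    then have "loaded_path_repeat t v" using nofree by blast
    moreover from this have "path s v" by (simp add: loaded_path_repeat_def repeat_def)
    ultimately show "leaf t v" using lpr ch by (auto simp: leaf_def kids_def)
  qed
  moreover have "closed_seqt (lab t v) \<or> loaded_path_repeat t v" if "leaf t v" for v
  proof -
    have v: "path s v" "kids (run s v) = []" using that ch[of v] by (auto simp: leaf_def)
    show ?thesis
    proof (rule ccontr)
      assume "\<not> ?thesis"
      then have nc: "\<not> closed_seqt (snd (run s v))" "snd (run s v) \<notin> fst (run s v)" using lpr[OF v(1)] by auto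
      obtain k where "refut k (fst (run s v)) (snd (run s v))"
        using winning_run[OF win v(1)] by (auto simp: winning_def)
      then have "good_move (run s v) (strat (run s v))"
        using good_move_strat nc by (metis prod.collapse)
      then show False using v(2) nc by (auto simp: kids_def good_move_def)
    qed
  qed
  ultimately have "closed_PDL_tableau t" by (simp add: closed_PDL_tableau_def)
  then show ?thesis by (intro exI[of _ t]) (simp add: s_def)
qed

section \<open>Local rules\<close>

text \<open>A uniform description of the local rules for unloaded formulas. An atomic box, or its
  negation, expands only to itself, hence the guard \<open>\<not> basic_fm \<phi>\<close> in the
  lemmas below.\<close>

fun expansions :: "('p, 'a) fm \<Rightarrow> ('p, 'a) fm set set" where
  "expansions (Neg (Neg \<phi>)) = {{\<phi>}}"
| "expansions (Conj \<phi> \<psi>) = {{\<phi>, \<psi>}}"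
| "expansions (Neg (Conj \<phi> \<psi>)) = {{Neg \<phi>}, {Neg \<psi>}}"
| "expansions (Box \<alpha> \<phi>) = unfold_box \<alpha> \<phi>"
| "expansions (Neg (Box \<alpha> \<phi>)) = unfold_dia \<alpha> \<phi>"
| "expansions _ = {}"

lemma nonbasic_cases:
  assumes "\<not> basic_fm \<phi>"
  obtains (NegNeg) \<psi> where "\<phi> = Neg (Neg \<psi>)"
  | (Conj) \<psi> \<chi> where "\<phi> = Conj \<psi> \<chi>"
  | (NegConj) \<psi> \<chi> where "\<phi> = Neg (Conj \<psi> \<chi>)"
  | (Box) \<alpha> \<psi> where "\<phi> = Box \<alpha> \<psi>" "\<not> is_atomic \<alpha>"
  | (NegBox) \<alpha> \<psi> where "\<phi> = Neg (Box \<alpha> \<psi>)" "\<not> is_atomic \<alpha>"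
proof (cases \<phi>)
  case (Neg \<psi>)
  then show ?thesis using assms that by (cases \<psi>) (auto simp: basic_fm_def is_atomic_def)
qed (use assms that in \<open>auto simp: basic_fm_def is_atomic_def\<close>)

lemma basic_fm_simps [simp]:
  "basic_fm Bot" "basic_fm (Neg Bot)" "basic_fm (Prop p)" "basic_fm (Neg (Prop p))"
  "basic_fm (Box \<alpha> \<phi>) \<longleftrightarrow> is_atomic \<alpha>" "basic_fm (Neg (Box \<alpha> \<phi>)) \<longleftrightarrow> is_atomic \<alpha>"
  "\<not> basic_fm (Neg (Neg \<phi>))" "\<not> basic_fm (Conj \<phi> \<psi>)" "\<not> basic_fm (Neg (Conj \<phi> \<psi>))"
  by (auto simp: basic_fm_def is_atomic_def)

lemma is_atomic_simps [simp]:
  "is_atomic (Atomic a)" "\<not> is_atomic (Test \<tau>)" "\<not> is_atomic (Choice \<alpha> \<beta>)"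
  "\<not> is_atomic (Seq \<alpha> \<beta>)" "\<not> is_atomic (Star \<alpha>)"
  by (auto simp: is_atomic_def)

lemma boxes_append [simp]: "boxes (ds @ es) \<phi> = boxes ds (boxes es \<phi>)"
  by (induction ds) auto

lemma lboxes_append [simp]: "lboxes (ds @ es) \<phi> = lboxes ds (lboxes es \<phi>)"
  by (induction ds) auto

lemma prog_induct [case_names Atomic Test Choice Seq Star]:
  assumes "\<And>a. P (Atomic a)" "\<And>\<tau>. P (Test \<tau>)" "\<And>\<alpha> \<beta>. P \<alpha> \<Longrightarrow> P \<beta> \<Longrightarrow> P (Choice \<alpha> \<beta>)"
    "\<And>\<alpha> \<beta>. P \<alpha> \<Longrightarrow> P \<beta> \<Longrightarrow> P (Seq \<alpha> \<beta>)" "\<And>\<alpha>. P \<alpha> \<Longrightarrow> P (Star \<alpha>)"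
  shows "P \<alpha>"
  using assms by (rule Tests.induct)

lemma H_dia_nonempty: "H_dia \<alpha> \<noteq> {}"
proof (induction \<alpha> rule: prog_induct)
  case (Seq \<alpha> \<beta>)
  then obtain Y ds Z es where "(Y, ds) \<in> H_dia \<alpha>" "(Z, es) \<in> H_dia \<beta>" by fast
  then show ?case by (cases "ds = []") auto
qed auto

lemma expansions_nonempty: "\<not> basic_fm \<phi> \<Longrightarrow> expansions \<phi> \<noteq> {}"
proof (erule nonbasic_cases)
  fix \<alpha> \<psi> assume "\<phi> = Neg (Box \<alpha> \<psi>)"
  then show ?thesis using H_dia_nonempty[of \<alpha>] by (auto simp: unfold_dia_def)
qed (auto simp: unfold_box_def)

lemma expansions_rule:
  assumes "\<not> basic_fm \<phi>" "Free \<phi> \<notin> \<Delta>"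
  obtains r where "r \<noteq> RLMinus" "rule_inst r (insert (Free \<phi>) \<Delta>) {\<Delta> \<union> Free ` \<Gamma> | \<Gamma>. \<Gamma> \<in> expansions \<phi>}"
  using assms(1)
proof (cases rule: nonbasic_cases)
  case (NegNeg \<psi>)
  have "{\<Delta> \<union> Free ` \<Gamma> | \<Gamma>. \<Gamma> \<in> expansions \<phi>} = {insert (Free \<psi>) \<Delta>}" using NegNeg by auto
  then show ?thesis using that[of RNeg] rule_inst.neg[of \<psi> \<Delta>] assms(2) NegNeg by simp
next
  case (Conj \<psi> \<chi>)
  have "{\<Delta> \<union> Free ` \<Gamma> | \<Gamma>. \<Gamma> \<in> expansions \<phi>} = {insert (Free \<psi>) (insert (Free \<chi>) \<Delta>)}" using Conj by auto
  then show ?thesis using that[of RConj] rule_inst.conj[of \<psi> \<chi> \<Delta>] assms(2) Conj by simp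
next
  case (NegConj \<psi> \<chi>)
  have "{\<Delta> \<union> Free ` \<Gamma> | \<Gamma>. \<Gamma> \<in> expansions \<phi>} = {insert (Free (Neg \<psi>)) \<Delta>, insert (Free (Neg \<chi>)) \<Delta>}"
    using NegConj by auto
  then show ?thesis using that[of RNegConj] rule_inst.neg_conj[of \<psi> \<chi> \<Delta>] assms(2) NegConj by simp
next
  case (Box \<alpha> \<psi>)
  then show ?thesis using that[of RBox] rule_inst.box[of \<alpha> \<psi> \<Delta>] assms(2) by simp
next
  case (NegBox \<alpha> \<psi>)
  then show ?thesis using that[of RDia] rule_inst.dia[of \<alpha> \<psi> \<Delta>] assms(2) by simp
qed

text \<open>A pending program is appended only behind a nonempty list, so the head always stems from
  an atomic part. Consequently an unfolded box is basic unless its list is empty.\<close>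

lemma P_box_head: "ds \<in> P_box l \<alpha> \<Longrightarrow> ds = [] \<or> (\<exists>a es. ds = Atomic a # es)"
proof (induction \<alpha> arbitrary: ds rule: prog_induct)
  case (Choice \<alpha> \<beta>)
  from Choice.prems show ?case using Choice.IH(1)[of ds] Choice.IH(2)[of ds] by auto
next
  case (Seq \<alpha> \<beta>)
  from Seq.prems consider bs where "ds = bs @ [\<beta>]" "bs \<in> P_box l \<alpha>" "bs \<noteq> []" | "ds \<in> P_box l \<beta>" by auto
  then show ?case
  proof cases
    case 1
    then show ?thesis using Seq.IH(1)[of bs] by auto
  qed (rule Seq.IH(2))
next
  case (Star \<alpha>)
  from Star.prems consider "ds = []" | bs where "ds = bs @ [Star \<alpha>]" "bs \<in> P_box l \<alpha>" "bs \<noteq> []" by auto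
  then show ?case
  proof cases
    case 2
    then show ?thesis using Star.IH[of bs] by auto
  qed auto
qed (auto split: if_splits)

text \<open>An unfolded diamond is thus either fulfilled on the spot or begins with an atomic
  program, and then (L+) can load it.\<close>

lemma H_dia_head: "(Y, ds) \<in> H_dia \<alpha> \<Longrightarrow> ds = [] \<or> (\<exists>a es. ds = Atomic a # es)"
proof (induction \<alpha> arbitrary: Y ds rule: prog_induct)
  case (Choice \<alpha> \<beta>)
  from Choice.prems show ?case using Choice.IH(1)[of Y ds] Choice.IH(2)[of Y ds] by auto
next
  case (Seq \<alpha> \<beta>)
  from Seq.prems consider bs where "ds = bs @ [\<beta>]" "(Y, bs) \<in> H_dia \<alpha>" "bs \<noteq> []" | Z where "(Z, ds) \<in> H_dia \<beta>"
    by auto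
  then show ?case
  proof cases
    case 1
    then show ?thesis using Seq.IH(1)[of Y bs] by auto
  qed (rule Seq.IH(2))
next
  case (Star \<alpha>)
  from Star.prems consider "ds = []" | bs where "ds = bs @ [Star \<alpha>]" "(Y, bs) \<in> H_dia \<alpha>" "bs \<noteq> []" by auto
  then show ?case
  proof cases
    case 2
    then show ?thesis using Star.IH[of Y bs] by auto
  qed auto
qed auto

lemma H_dia_Tests: "(Y, ds) \<in> H_dia \<alpha> \<Longrightarrow> Y \<subseteq> Tests \<alpha>"
proof (induction \<alpha> arbitrary: Y ds rule: prog_induct)
  case (Choice \<alpha> \<beta>)
  from Choice.prems show ?case using Choice.IH(1)[of Y ds] Choice.IH(2)[of Y ds] by auto
next
  case (Seq \<alpha> \<beta>)
  from Seq.prems consider bs where "(Y, bs) \<in> H_dia \<alpha>" | X Z where "Y = X \<union> Z" "(X, []) \<in> H_dia \<alpha>" "(Z, ds) \<in> H_dia \<beta>"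
    by auto
  then show ?case by cases (use Seq.IH in force)+
qed auto

text \<open>The listed programs are parts of \<alpha>, so a hypothesis about the tests of \<alpha>
  survives unfolding.\<close>

lemma H_dia_Tests_list: "(Y, ds) \<in> H_dia \<alpha> \<Longrightarrow> d \<in> set ds \<Longrightarrow> Tests d \<subseteq> Tests \<alpha>"
proof (induction \<alpha> arbitrary: Y ds rule: prog_induct)
  case (Choice \<alpha> \<beta>)
  from Choice.prems show ?case using Choice.IH(1)[of Y ds] Choice.IH(2)[of Y ds] by auto
next
  case (Seq \<alpha> \<beta>)
  from Seq.prems(1) consider bs where "ds = bs @ [\<beta>]" "(Y, bs) \<in> H_dia \<alpha>" | Z where "(Z, ds) \<in> H_dia \<beta>" by auto
  then show ?case
  proof cases
    case 1
    then show ?thesis using Seq.IH(1)[of Y bs] Seq.prems(2) by auto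
  next
    case 2
    then show ?thesis using Seq.IH(2)[of Z ds] Seq.prems(2) by auto
  qed
next
  case (Star \<alpha>)
  from Star.prems obtain bs where "ds = bs @ [Star \<alpha>]" "(Y, bs) \<in> H_dia \<alpha>" by auto
  then show ?case using Star.IH[of Y bs] Star.prems(2) by auto
qed auto

lemma finite_Tests [simp]: "finite (Tests \<alpha>)"
  by (induction \<alpha> rule: prog_induct) auto

lemma P_box_cong: "l \<inter> Tests \<alpha> = l' \<inter> Tests \<alpha> \<Longrightarrow> P_box l \<alpha> = P_box l' \<alpha>"
proof (induction \<alpha> rule: prog_induct)
  case (Test \<tau>) then show ?case by auto
next
  case (Choice \<alpha> \<beta>)
  then have "P_box l \<alpha> = P_box l' \<alpha>" "P_box l \<beta> = P_box l' \<beta>" by (auto simp: Int_Un_distrib)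
  then show ?case by simp
next
  case (Seq \<alpha> \<beta>)
  then have "P_box l \<alpha> = P_box l' \<alpha>" "P_box l \<beta> = P_box l' \<beta>" by (auto simp: Int_Un_distrib)
  then show ?case by simp
qed auto

section \<open>Termination of local expansion\<close>

text \<open>A test counts \<open>weight \<tau> + 2\<close> so that a program outweighs all its tests
  even after each has been negated, as in \<open>F_box\<close>. The weight 1 of atomic programs
  keeps this strict when there are no tests.\<close>

primrec weight :: "('p, 'a) fm \<Rightarrow> nat" and pweight :: "('p, 'a) prog \<Rightarrow> nat" where
  "weight Bot = 0"
| "weight (Prop p) = 0"
| "weight (Neg \<phi>) = weight \<phi> + 1"
| "weight (Conj \<phi> \<psi>) = weight \<phi> + weight \<psi> + 2"
| "weight (Box \<alpha> \<phi>) = pweight \<alpha> + weight \<phi>"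
| "pweight (Atomic a) = 1"
| "pweight (Test \<tau>) = weight \<tau> + 2"
| "pweight (Choice \<alpha> \<beta>) = pweight \<alpha> + pweight \<beta>"
| "pweight (Seq \<alpha> \<beta>) = pweight \<alpha> + pweight \<beta>"
| "pweight (Star \<alpha>) = pweight \<alpha>"

text \<open>
  Basic formulas weigh nothing: unfolding \<open>[\<alpha>]\<psi>\<close> may produce many and large formulas, but apart
  from \<open>\<psi>\<close> and the tests of \<open>\<alpha>\<close> they all begin with an atomic box.
\<close>

definition local_weight :: "('p, 'a) fm \<Rightarrow> nat" where
  "local_weight \<phi> = (if basic_fm \<phi> then 0 else weight \<phi>)"

lemma sum_Un_le: "finite A \<Longrightarrow> finite B \<Longrightarrow> sum f (A \<union> B) \<le> sum f A + (sum f B :: nat)"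
  by (metis le_add1 sum.union_inter)

lemma Tests_weight: "(\<Sum>\<tau>\<in>Tests \<alpha>. weight \<tau> + 1) < pweight \<alpha>"
proof (induction \<alpha> rule: prog_induct)
  case (Choice \<alpha> \<beta>)
  then show ?case using sum_Un_le[of "Tests \<alpha>" "Tests \<beta>" "\<lambda>\<tau>. weight \<tau> + 1"] by simp
next
  case (Seq \<alpha> \<beta>)
  then show ?case using sum_Un_le[of "Tests \<alpha>" "Tests \<beta>" "\<lambda>\<tau>. weight \<tau> + 1"] by simp
qed auto

lemma sum_local_weight_le:
  assumes "finite A" "finite S" "A \<subseteq> S \<union> Collect basic_fm"
  shows "sum local_weight A \<le> sum weight S"
proof -
  have "sum local_weight A = sum local_weight (A - Collect basic_fm)"
    using assms(1) by (intro sum.mono_neutral_right) (auto simp: local_weight_def)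
  also have "\<dots> \<le> sum local_weight S" using assms by (intro sum_mono2) auto
  also have "\<dots> \<le> sum weight S" by (intro sum_mono) (auto simp: local_weight_def)
  finally show ?thesis .
qed

text \<open>Sums over sets count shared formulas once, so replacing \<phi> by \<Gamma> in a finite
  sequent lowers the total local weight.\<close>

lemma expansions_weight:
  assumes "\<not> basic_fm \<phi>" "\<Gamma> \<in> expansions \<phi>" "finite \<Gamma>"
  shows "sum local_weight \<Gamma> < local_weight \<phi>"
  using assms(1)
proof (cases rule: nonbasic_cases)
  case (NegNeg \<psi>)
  then show ?thesis using assms by (auto simp: local_weight_def)
next
  case (Conj \<psi> \<chi>)
  have "sum weight {\<psi>, \<chi>} \<le> weight \<psi> + weight \<chi>" by (cases "\<psi> = \<chi>") auto
  then show ?thesis using sum_local_weight_le[of \<Gamma> "{\<psi>, \<chi>}"] assms Conj by (auto simp: local_weight_def)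
next
  case (NegConj \<psi> \<chi>)
  then show ?thesis using assms by (auto simp: local_weight_def)
next
  case (Box \<alpha> \<psi>)
  then obtain l where l: "\<Gamma> = X_box l \<alpha> \<psi>" using assms by (auto simp: unfold_box_def)
  have "\<Gamma> \<subseteq> insert \<psi> (Neg ` Tests \<alpha>) \<union> Collect basic_fm"
    using P_box_head unfolding l X_box_def F_box_def by fastforce
  then have "sum local_weight \<Gamma> \<le> sum weight (insert \<psi> (Neg ` Tests \<alpha>))"
    using assms(3) by (intro sum_local_weight_le) auto
  also have "\<dots> \<le> weight \<psi> + sum weight (Neg ` Tests \<alpha>)"
    using sum_Un_le[of "{\<psi>}" "Neg ` Tests \<alpha>" weight] by simp
  also have "sum weight (Neg ` Tests \<alpha>) = (\<Sum>\<tau>\<in>Tests \<alpha>. weight \<tau> + 1)"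
    by (subst sum.reindex) (auto simp: inj_on_def)
  also have "weight \<psi> + \<dots> < local_weight \<phi>"
    using Tests_weight[of \<alpha>] Box by (simp add: local_weight_def)
  finally show ?thesis .
next
  case (NegBox \<alpha> \<psi>)
  then obtain Y ds where Y: "\<Gamma> = Y \<union> {Neg (boxes ds \<psi>)}" "(Y, ds) \<in> H_dia \<alpha>"
    using assms by (auto simp: unfold_dia_def)
  have "\<Gamma> \<subseteq> insert (Neg \<psi>) (Tests \<alpha>) \<union> Collect basic_fm"
    using H_dia_head[OF Y(2)] H_dia_Tests[OF Y(2)] unfolding Y(1) by fastforce
  then have "sum local_weight \<Gamma> \<le> sum weight (insert (Neg \<psi>) (Tests \<alpha>))"
    using assms(3) by (intro sum_local_weight_le) auto
  also have "\<dots> \<le> weight (Neg \<psi>) + sum weight (Tests \<alpha>)"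
    using sum_Un_le[of "{Neg \<psi>}" "Tests \<alpha>" weight] by simp
  also have "sum weight (Tests \<alpha>) \<le> (\<Sum>\<tau>\<in>Tests \<alpha>. weight \<tau> + 1)"
    by (intro sum_mono) auto
  also have "weight (Neg \<psi>) + \<dots> < local_weight \<phi>"
    using Tests_weight[of \<alpha>] NegBox by (simp add: local_weight_def)
  finally show ?thesis by simp
qed

section \<open>Fischer-Ladner closure\<close>

text \<open>The closure of \<open>[\<alpha>]\<psi>\<close> short of what \<open>\<psi>\<close> and
  the tests contribute. Recursion is on \<alpha> alone, with pending programs pushed into the second
  argument; this gives finiteness even for iteration, whose box recurs unchanged.\<close>

fun fl_box :: "('p, 'a) prog \<Rightarrow> ('p, 'a) fm \<Rightarrow> ('p, 'a) fm set" where
  "fl_box (Atomic a) \<psi> = {Box (Atomic a) \<psi>}"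
| "fl_box (Test \<tau>) \<psi> = {Box (Test \<tau>) \<psi>}"
| "fl_box (Choice \<alpha> \<beta>) \<psi> = insert (Box (Choice \<alpha> \<beta>) \<psi>) (fl_box \<alpha> \<psi> \<union> fl_box \<beta> \<psi>)"
| "fl_box (Seq \<alpha> \<beta>) \<psi> = insert (Box (Seq \<alpha> \<beta>) \<psi>) (fl_box \<alpha> (Box \<beta> \<psi>) \<union> fl_box \<beta> \<psi>)"
| "fl_box (Star \<alpha>) \<psi> = insert (Box (Star \<alpha>) \<psi>) (fl_box \<alpha> (Box (Star \<alpha>) \<psi>))"

lemma finite_fl_box [simp]: "finite (fl_box \<alpha> \<psi>)"
  by (induction \<alpha> arbitrary: \<psi> rule: prog_induct) auto

lemma Box_in_fl_box [simp]: "Box \<alpha> \<psi> \<in> fl_box \<alpha> \<psi>"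
  by (cases \<alpha>) auto

lemma fl_box_is_box: "\<chi> \<in> fl_box \<alpha> \<psi> \<Longrightarrow> \<exists>\<beta> \<phi>. \<chi> = Box \<beta> \<phi>"
  by (induction \<alpha> arbitrary: \<psi> rule: prog_induct) auto

text \<open>The body of a box found here is \<psi> or a pending box. In the sequence and iteration
  cases the extended second argument is itself a member of the set, so nothing leads
  outside.\<close>

lemma fl_box_trans:
  "Box \<beta> \<chi> \<in> fl_box \<alpha> \<psi> \<Longrightarrow>
    fl_box \<beta> \<chi> \<subseteq> fl_box \<alpha> \<psi> \<and> \<chi> \<in> insert \<psi> (fl_box \<alpha> \<psi>) \<and> Tests \<beta> \<subseteq> Tests \<alpha>"
proof (induction \<alpha> arbitrary: \<psi> rule: prog_induct)
  case (Seq \<alpha>1 \<alpha>2)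
  then consider "Box \<beta> \<chi> = Box (Seq \<alpha>1 \<alpha>2) \<psi>" | "Box \<beta> \<chi> \<in> fl_box \<alpha>1 (Box \<alpha>2 \<psi>)" | "Box \<beta> \<chi> \<in> fl_box \<alpha>2 \<psi>"
    by auto
  then show ?case
  proof cases
    case 2
    then show ?thesis using Seq.IH(1)[OF 2] by auto
  next
    case 3
    then show ?thesis using Seq.IH(2)[OF 3] by auto
  qed auto
next
  case (Choice \<alpha>1 \<alpha>2)
  then consider "Box \<beta> \<chi> = Box (Choice \<alpha>1 \<alpha>2) \<psi>" | "Box \<beta> \<chi> \<in> fl_box \<alpha>1 \<psi>" | "Box \<beta> \<chi> \<in> fl_box \<alpha>2 \<psi>"
    by auto
  then show ?case
  proof cases
    case 2
    then show ?thesis using Choice.IH(1)[OF 2] by auto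
  next
    case 3
    then show ?thesis using Choice.IH(2)[OF 3] by auto
  qed auto
next
  case (Star \<alpha>)
  then consider "Box \<beta> \<chi> = Box (Star \<alpha>) \<psi>" | "Box \<beta> \<chi> \<in> fl_box \<alpha> (Box (Star \<alpha>) \<psi>)" by auto
  then show ?case
  proof cases
    case 2
    then show ?thesis using Star.IH[OF 2] by auto
  qed auto
qed auto

text \<open>An appended program is absorbed into the body,
  \<open>boxes (bs @ [\<beta>]) \<psi>\<close> being \<open>boxes bs (Box \<beta> \<psi>)\<close>;
  hence the induction generalises \<psi>.\<close>

lemma P_box_fl_box: "ds \<in> P_box l \<alpha> \<Longrightarrow> boxes ds \<psi> \<in> insert \<psi> (fl_box \<alpha> \<psi>)"
proof (induction \<alpha> arbitrary: ds \<psi> rule: prog_induct)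
  case (Choice \<alpha> \<beta>)
  from Choice.prems show ?case using Choice.IH(1)[of ds \<psi>] Choice.IH(2)[of ds \<psi>] by auto
next
  case (Seq \<alpha> \<beta>)
  from Seq.prems consider bs where "ds = bs @ [\<beta>]" "bs \<in> P_box l \<alpha>" | "ds \<in> P_box l \<beta>" by auto
  then show ?case
  proof cases
    case 1
    then show ?thesis using Seq.IH(1)[of bs "Box \<beta> \<psi>"] by auto
  qed (use Seq.IH(2)[of ds \<psi>] in auto)
next
  case (Star \<alpha>)
  from Star.prems consider "ds = []" | bs where "ds = bs @ [Star \<alpha>]" "bs \<in> P_box l \<alpha>" by auto
  then show ?case
  proof cases
    case 2
    then show ?thesis using Star.IH[of bs "Box (Star \<alpha>) \<psi>"] by auto
  qed auto
qed (auto split: if_splits)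

lemma H_dia_fl_box: "(Y, ds) \<in> H_dia \<alpha> \<Longrightarrow> boxes ds \<psi> \<in> insert \<psi> (fl_box \<alpha> \<psi>)"
proof (induction \<alpha> arbitrary: Y ds \<psi> rule: prog_induct)
  case (Choice \<alpha> \<beta>)
  from Choice.prems show ?case using Choice.IH(1)[of Y ds \<psi>] Choice.IH(2)[of Y ds \<psi>] by auto
next
  case (Seq \<alpha> \<beta>)
  from Seq.prems consider bs where "ds = bs @ [\<beta>]" "(Y, bs) \<in> H_dia \<alpha>" | Z where "(Z, ds) \<in> H_dia \<beta>" by auto
  then show ?case
  proof cases
    case 1
    then show ?thesis using Seq.IH(1)[of Y bs "Box \<beta> \<psi>"] by auto
  next
    case 2
    then show ?thesis using Seq.IH(2)[of Z ds \<psi>] by auto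
  qed
next
  case (Star \<alpha>)
  from Star.prems consider "ds = []" | bs where "ds = bs @ [Star \<alpha>]" "(Y, bs) \<in> H_dia \<alpha>" by auto
  then show ?case
  proof cases
    case 2
    then show ?thesis using Star.IH[of Y bs "Box (Star \<alpha>) \<psi>"] by auto
  qed auto
qed auto

primrec fl :: "('p, 'a) fm \<Rightarrow> ('p, 'a) fm set" and fl_tests :: "('p, 'a) prog \<Rightarrow> ('p, 'a) fm set" where
  "fl Bot = {Bot}"
| "fl (Prop p) = {Prop p}"
| "fl (Neg \<phi>) = insert (Neg \<phi>) (fl \<phi>)"
| "fl (Conj \<phi> \<psi>) = insert (Conj \<phi> \<psi>) (fl \<phi> \<union> fl \<psi>)"
| "fl (Box \<alpha> \<phi>) = fl_box \<alpha> \<phi> \<union> fl \<phi> \<union> fl_tests \<alpha>"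
| "fl_tests (Atomic a) = {}"
| "fl_tests (Test \<tau>) = fl \<tau>"
| "fl_tests (Choice \<alpha> \<beta>) = fl_tests \<alpha> \<union> fl_tests \<beta>"
| "fl_tests (Seq \<alpha> \<beta>) = fl_tests \<alpha> \<union> fl_tests \<beta>"
| "fl_tests (Star \<alpha>) = fl_tests \<alpha>"

lemma fl_refl [simp]: "\<phi> \<in> fl \<phi>"
  by (cases \<phi>) auto

lemma Tests_fl_tests: "Tests \<alpha> \<subseteq> fl_tests \<alpha>"
  by (induction \<alpha> rule: prog_induct) auto

lemma finite_fl: "finite (fl (\<phi> :: ('p, 'a) fm))" and finite_fl_tests: "finite (fl_tests (\<alpha> :: ('p, 'a) prog))"
  by (induction \<phi> and \<alpha> rule: fm.induct prog.induct) auto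

text \<open>One step of closure. With all of \<open>fl_box\<close> included in the box case, closure
  under unfolding reduces to \<open>P_box_fl_box\<close> and \<open>H_dia_fl_box\<close>.\<close>

primrec fl_parts :: "('p, 'a) fm \<Rightarrow> ('p, 'a) fm set" where
  "fl_parts Bot = {}"
| "fl_parts (Prop p) = {}"
| "fl_parts (Neg \<phi>) = {\<phi>}"
| "fl_parts (Conj \<phi> \<psi>) = {\<phi>, \<psi>}"
| "fl_parts (Box \<alpha> \<phi>) = insert \<phi> (fl_box \<alpha> \<phi> \<union> Tests \<alpha>)"

definition fl_closed :: "('p, 'a) fm set \<Rightarrow> bool" where
  "fl_closed C \<longleftrightarrow> (\<forall>\<phi>\<in>C. fl_parts \<phi> \<subseteq> C)"

lemma fl_closed_UN: "(\<And>x. x \<in> I \<Longrightarrow> fl_closed (A x)) \<Longrightarrow> fl_closed (\<Union>x\<in>I. A x)"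
  unfolding fl_closed_def by blast

lemma fl_closed_Un: "fl_closed A \<Longrightarrow> fl_closed B \<Longrightarrow> fl_closed (A \<union> B)"
  unfolding fl_closed_def by blast

lemma fl_closed_insert: "fl_closed C \<Longrightarrow> fl_parts \<phi> \<subseteq> C \<Longrightarrow> fl_closed (insert \<phi> C)"
  unfolding fl_closed_def by blast

lemma fl_box_parts: "\<chi> \<in> fl_box \<alpha> \<psi> \<Longrightarrow> fl_parts \<chi> \<subseteq> insert \<psi> (fl_box \<alpha> \<psi> \<union> Tests \<alpha>)"
  using fl_box_is_box[of \<chi> \<alpha> \<psi>] fl_box_trans[of _ _ \<alpha> \<psi>] by fastforce

lemma fl_closed_fl: "fl_closed (fl (\<phi> :: ('p, 'a) fm))"
  and fl_closed_fl_tests: "fl_closed (fl_tests (\<alpha> :: ('p, 'a) prog))"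
proof (induction \<phi> and \<alpha> rule: fm.induct prog.induct)
  case (Neg \<phi>)
  then show ?case by (auto intro: fl_closed_insert)
next
  case (Conj \<phi> \<psi>)
  then show ?case using fl_closed_insert[OF fl_closed_Un[OF Conj], of "Conj \<phi> \<psi>"] by simp
next
  case (Box \<alpha> \<phi>)
  have "fl_closed (fl \<phi> \<union> fl_tests \<alpha>)" using fl_closed_Un Box by blast
  moreover have "\<phi> \<in> fl \<phi>" "Tests \<alpha> \<subseteq> fl_tests \<alpha>" using Tests_fl_tests by auto
  ultimately show ?case
    using fl_box_parts[of _ \<alpha> \<phi>] unfolding fl_closed_def fl.simps by blast
qed (simp_all add: fl_closed_Un, simp_all add: fl_closed_def)

text \<open>What the rules ask of the ambient set: closure under local expansion, and, in the last
  two assumptions, under the modal rule.\<close>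

locale closed_set =
  fixes D :: "('p, 'a) fm set"
  assumes finite_D: "finite D"
    and expansions_D: "\<lbrakk>\<phi> \<in> D; \<not> basic_fm \<phi>; \<Gamma> \<in> expansions \<phi>\<rbrakk> \<Longrightarrow> \<Gamma> \<subseteq> D"
    and Box_D: "Box (Atomic a) \<phi> \<in> D \<Longrightarrow> \<phi> \<in> D"
    and Neg_Box_D: "Neg (Box (Atomic a) \<phi>) \<in> D \<Longrightarrow> Neg \<phi> \<in> D"

text \<open>One layer of negations suffices: expanding a member of \<open>C\<close>, or the negation
  of one, yields members of \<open>C\<close> and negations of members.\<close>

lemma closed_set_fl:
  assumes "finite \<Gamma>"
  defines "C \<equiv> (\<Union>\<phi>\<in>\<Gamma>. fl \<phi>)"
  shows "closed_set (C \<union> Neg ` C)"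
proof
  have C: "fl_closed C" unfolding C_def by (intro fl_closed_UN fl_closed_fl)
  have parts: "fl_parts \<phi> \<subseteq> C" if "\<phi> \<in> C" for \<phi> using C that by (simp add: fl_closed_def)
  have cn: "\<phi> \<in> C" if "Neg \<phi> \<in> C" for \<phi> using parts[OF that] by simp
  have cc: "\<phi> \<in> C \<and> \<psi> \<in> C" if "Conj \<phi> \<psi> \<in> C" for \<phi> \<psi> using parts[OF that] by simp
  have cb: "\<phi> \<in> C \<and> fl_box \<alpha> \<phi> \<subseteq> C \<and> Tests \<alpha> \<subseteq> C" if "Box \<alpha> \<phi> \<in> C" for \<alpha> \<phi> using parts[OF that] by simp
  show "finite (C \<union> Neg ` C)" using assms(1) by (auto simp: C_def finite_fl)
  show "\<phi> \<in> C \<union> Neg ` C" if "Box (Atomic a) \<phi> \<in> C \<union> Neg ` C" for a \<phi> using that cb by blast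
  show "Neg \<phi> \<in> C \<union> Neg ` C" if "Neg (Box (Atomic a) \<phi>) \<in> C \<union> Neg ` C" for a \<phi>
    using that cb cn by blast
  show "X \<subseteq> C \<union> Neg ` C" if \<phi>: "\<phi> \<in> C \<union> Neg ` C" and nb: "\<not> basic_fm \<phi>" and X: "X \<in> expansions \<phi>" for \<phi> X
    using nb
  proof (cases rule: nonbasic_cases)
    case (NegNeg \<psi>)
    then have "\<psi> \<in> C" using \<phi> cn by blast
    then show ?thesis using X NegNeg by auto
  next
    case (Conj \<psi> \<chi>)
    then have "\<psi> \<in> C \<and> \<chi> \<in> C" using \<phi> cc by blast
    then show ?thesis using X Conj by auto
  next
    case (NegConj \<psi> \<chi>)
    then have "Conj \<psi> \<chi> \<in> C" using \<phi> cn by blast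
    then have "\<psi> \<in> C \<and> \<chi> \<in> C" using cc by blast
    then show ?thesis using X NegConj by auto
  next
    case (Box \<alpha> \<psi>)
    then have b: "\<psi> \<in> C" "fl_box \<alpha> \<psi> \<subseteq> C" "Tests \<alpha> \<subseteq> C" using \<phi> cb by blast+
    obtain l where l: "X = X_box l \<alpha> \<psi>" using X Box by (auto simp: unfold_box_def)
    have "boxes ds \<psi> \<in> C" if "ds \<in> P_box l \<alpha>" for ds using b P_box_fl_box[OF that, of \<psi>] by auto
    then show ?thesis using b(3) unfolding l X_box_def F_box_def by blast
  next
    case (NegBox \<alpha> \<psi>)
    then have "Box \<alpha> \<psi> \<in> C" using \<phi> cn by blast
    then have b: "\<psi> \<in> C" "fl_box \<alpha> \<psi> \<subseteq> C" "Tests \<alpha> \<subseteq> C" using cb by blast+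
    obtain Y ds where Y: "X = Y \<union> {Neg (boxes ds \<psi>)}" "(Y, ds) \<in> H_dia \<alpha>"
      using X NegBox by (auto simp: unfold_dia_def)
    have "boxes ds \<psi> \<in> C" using b H_dia_fl_box[OF Y(2), of \<psi>] by auto
    then show ?thesis using b(3) H_dia_Tests[OF Y(2)] unfolding Y(1) by blast
  qed
qed

section \<open>Unloading\<close>

primrec unload_xi :: "('p, 'a) xi \<Rightarrow> ('p, 'a) fm" where
  "unload_xi (Unmarked \<phi>) = \<phi>"
| "unload_xi (LBox \<alpha> \<xi>) = Box \<alpha> (unload_xi \<xi>)"

primrec unload :: "('p, 'a) sfm \<Rightarrow> ('p, 'a) fm" where
  "unload (Free \<phi>) = \<phi>"
| "unload (NegLBox \<alpha> \<xi>) = Neg (Box \<alpha> (unload_xi \<xi>))"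

lemma unload_neg_xi [simp]: "unload (neg_xi \<xi>) = Neg (unload_xi \<xi>)"
  by (cases \<xi>) auto

lemma unload_xi_lboxes [simp]: "unload_xi (lboxes ds \<xi>) = boxes ds (unload_xi \<xi>)"
  by (induction ds) auto

lemma xi_lboxes: "\<exists>\<alpha>s \<phi>. \<xi> = lboxes \<alpha>s (Unmarked \<phi>)"
proof (induction \<xi>)
  case (Unmarked \<phi>)
  then show ?case by (metis lboxes.simps(1))
next
  case (LBox \<alpha> \<xi>)
  then show ?case by (metis lboxes.simps(2))
qed

text \<open>Supplies the maximal prefix of boxes that (L+) has to load.\<close>

lemma fm_boxes: "\<exists>\<alpha>s \<chi>. \<phi> = boxes \<alpha>s \<chi> \<and> \<not> is_box \<chi>"
proof (induction \<phi> rule: measure_induct_rule[of size])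
  case (less \<phi>)
  show ?case
  proof (cases "is_box \<phi>")
    case True
    then obtain \<alpha> \<psi> where \<phi>: "\<phi> = Box \<alpha> \<psi>" by (auto simp: is_box_def)
    then obtain \<alpha>s \<chi> where "\<psi> = boxes \<alpha>s \<chi>" "\<not> is_box \<chi>" using less[of \<psi>] by auto
    then show ?thesis using \<phi> by (intro exI[of _ "\<alpha> # \<alpha>s"]) auto
  next
    case False
    then show ?thesis by (intro exI[of _ "[]"]) auto
  qed
qed

lemma finite_unload_xi: "finite {\<xi>. unload_xi \<xi> = \<phi>}"
proof (induction \<phi> rule: measure_induct_rule[of size])
  case (less \<phi>)
  show ?case
  proof (cases "is_box \<phi>")
    case True
    then obtain \<alpha> \<psi> where \<phi>: "\<phi> = Box \<alpha> \<psi>" by (auto simp: is_box_def)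
    have "unload_xi \<xi> = \<phi> \<Longrightarrow> \<xi> \<in> insert (Unmarked \<phi>) (LBox \<alpha> ` {\<xi>. unload_xi \<xi> = \<psi>})" for \<xi>
      using \<phi> by (cases \<xi>) auto
    then have "{\<xi>. unload_xi \<xi> = \<phi>} \<subseteq> insert (Unmarked \<phi>) (LBox \<alpha> ` {\<xi>. unload_xi \<xi> = \<psi>})" by blast
    moreover have "finite {\<xi>. unload_xi \<xi> = \<psi>}" using less[of \<psi>] \<phi> by simp
    ultimately show ?thesis by (meson finite_imageI finite_insert finite_subset)
  next
    case False
    have "unload_xi \<xi> = \<phi> \<Longrightarrow> \<xi> = Unmarked \<phi>" for \<xi>
      using False by (cases \<xi>) (auto simp: is_box_def)
    then have "{\<xi>. unload_xi \<xi> = \<phi>} \<subseteq> {Unmarked \<phi>}" by blast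
    then show ?thesis using finite_subset by blast
  qed
qed

text \<open>A marking is fixed by how many leading boxes it covers, so each formula has finitely
  many loaded versions. This makes the set of possible labels finite.\<close>

lemma finite_unload: "finite {\<theta>. unload \<theta> = \<phi>}"
proof -
  have "\<theta> \<in> insert (Free \<phi>) (neg_xi ` (\<Union>\<psi>\<in>fl_parts \<phi>. {\<xi>. unload_xi \<xi> = \<psi>}))" if "unload \<theta> = \<phi>" for \<theta>
  proof (cases \<theta>)
    case (NegLBox \<alpha> \<xi>)
    then have "\<theta> = neg_xi (LBox \<alpha> \<xi>)" "unload_xi (LBox \<alpha> \<xi>) \<in> fl_parts \<phi>" using that by auto
    then show ?thesis by blast
  qed (use that in auto)
  then have "{\<theta>. unload \<theta> = \<phi>} \<subseteq> insert (Free \<phi>) (neg_xi ` (\<Union>\<psi>\<in>fl_parts \<phi>. {\<xi>. unload_xi \<xi> = \<psi>}))" by blast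
  moreover have "finite (fl_parts \<phi>)" by (cases \<phi>) auto
  ultimately show ?thesis
    by (elim finite_subset) (intro finite.insertI finite_imageI finite_UN_I finite_unload_xi)
qed

lemma not_loaded_Free [simp]: "\<not> loaded (Free ` \<Delta>)"
  by (auto simp: loaded_def)

lemma loaded_insert_Free [simp]: "loaded (insert (Free \<phi>) \<Delta>) \<longleftrightarrow> loaded \<Delta>"
  by (auto simp: loaded_def)

lemma loaded_insert_NegLBox [simp]: "loaded (insert (NegLBox \<alpha> \<xi>) \<Delta>)"
  by (auto simp: loaded_def)

section \<open>Local entailment\<close>

inductive ent :: "('p, 'a) fm set \<Rightarrow> ('p, 'a) fm \<Rightarrow> bool" for B where
  ent_basic: "basic_fm \<phi> \<Longrightarrow> \<phi> \<in> B \<Longrightarrow> ent B \<phi>"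
| ent_expand: "\<not> basic_fm \<phi> \<Longrightarrow> \<Gamma> \<in> expansions \<phi> \<Longrightarrow> (\<And>\<psi>. \<psi> \<in> \<Gamma> \<Longrightarrow> ent B \<psi>) \<Longrightarrow> ent B \<phi>"

lemma ent_basic_iff: "basic_fm \<phi> \<Longrightarrow> ent B \<phi> \<longleftrightarrow> \<phi> \<in> B"
  by (auto simp: ent.simps[of B \<phi>])

lemma ent_nonbasic_iff: "\<not> basic_fm \<phi> \<Longrightarrow> ent B \<phi> \<longleftrightarrow> (\<exists>\<Gamma>\<in>expansions \<phi>. \<forall>\<psi>\<in>\<Gamma>. ent B \<psi>)"
  by (auto simp: ent.simps[of B \<phi>])

lemma ent_Box_iff:
  "ent B (Box \<alpha> \<phi>) \<longleftrightarrow>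
    (\<exists>l. (\<forall>\<tau>\<in>Tests \<alpha> - l. ent B (Neg \<tau>)) \<and> (\<forall>ds\<in>P_box l \<alpha>. ent B (boxes ds \<phi>)))" (is "?L \<longleftrightarrow> ?R")
proof (cases "is_atomic \<alpha>")
  case True
  then show ?thesis by (auto simp: is_atomic_def)
next
  case False
  have X: "(\<forall>\<psi>\<in>X_box l \<alpha> \<phi>. ent B \<psi>) \<longleftrightarrow>
    (\<forall>\<tau>\<in>Tests \<alpha> - l. ent B (Neg \<tau>)) \<and> (\<forall>ds\<in>P_box l \<alpha>. ent B (boxes ds \<phi>))" for l
    by (auto simp: X_box_def F_box_def)
  have "?L \<longleftrightarrow> (\<exists>l\<subseteq>Tests \<alpha>. \<forall>\<psi>\<in>X_box l \<alpha> \<phi>. ent B \<psi>)"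
    using False by (auto simp: ent_nonbasic_iff unfold_box_def)
  also have "\<dots> \<longleftrightarrow> (\<exists>l\<subseteq>Tests \<alpha>. (\<forall>\<tau>\<in>Tests \<alpha> - l. ent B (Neg \<tau>)) \<and> (\<forall>ds\<in>P_box l \<alpha>. ent B (boxes ds \<phi>)))"
    unfolding X ..
  also have "\<dots> \<longleftrightarrow> ?R"
  proof
    assume ?R
    then obtain l where l: "\<forall>\<tau>\<in>Tests \<alpha> - l. ent B (Neg \<tau>)" "\<forall>ds\<in>P_box l \<alpha>. ent B (boxes ds \<phi>)" by blast
    have "P_box (l \<inter> Tests \<alpha>) \<alpha> = P_box l \<alpha>" by (rule P_box_cong) auto
    then show "\<exists>l\<subseteq>Tests \<alpha>. (\<forall>\<tau>\<in>Tests \<alpha> - l. ent B (Neg \<tau>)) \<and> (\<forall>ds\<in>P_box l \<alpha>. ent B (boxes ds \<phi>))"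
      using l by (intro exI[of _ "l \<inter> Tests \<alpha>"]) auto
  qed blast
  finally show ?thesis .
qed

lemma ent_Neg_Box_iff:
  "ent B (Neg (Box \<alpha> \<phi>)) \<longleftrightarrow>
    (\<exists>Y ds. (Y, ds) \<in> H_dia \<alpha> \<and> (\<forall>\<tau>\<in>Y. ent B \<tau>) \<and> ent B (Neg (boxes ds \<phi>)))" (is "?L \<longleftrightarrow> ?R")
proof (cases "is_atomic \<alpha>")
  case True
  then show ?thesis by (auto simp: is_atomic_def)
next
  case False
  then have "?L \<longleftrightarrow> (\<exists>\<Gamma>\<in>unfold_dia \<alpha> \<phi>. \<forall>\<psi>\<in>\<Gamma>. ent B \<psi>)"
    by (simp add: ent_nonbasic_iff)
  also have "\<dots> \<longleftrightarrow> ?R"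
  proof
    assume "\<exists>\<Gamma>\<in>unfold_dia \<alpha> \<phi>. \<forall>\<psi>\<in>\<Gamma>. ent B \<psi>"
    then obtain Y ds where "(Y, ds) \<in> H_dia \<alpha>" "\<forall>\<psi>\<in>Y \<union> {Neg (boxes ds \<phi>)}. ent B \<psi>"
      by (auto simp: unfold_dia_def)
    then show ?R by auto
  next
    assume ?R
    then obtain Y ds where Y: "(Y, ds) \<in> H_dia \<alpha>" "\<forall>\<psi>\<in>Y \<union> {Neg (boxes ds \<phi>)}. ent B \<psi>" by auto
    then have "Y \<union> {Neg (boxes ds \<phi>)} \<in> unfold_dia \<alpha> \<phi>" by (auto simp: unfold_dia_def)
    then show "\<exists>\<Gamma>\<in>unfold_dia \<alpha> \<phi>. \<forall>\<psi>\<in>\<Gamma>. ent B \<psi>" using Y(2) by blast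
  qed
  finally show ?thesis .
qed

section \<open>Unrefuted sequents\<close>

definition unrefuted :: "('p, 'a) seqt set \<Rightarrow> ('p, 'a) seqt \<Rightarrow> bool" where
  "unrefuted h \<Sigma> \<longleftrightarrow> (\<forall>n. \<not> refut n h \<Sigma>)"

lemma unrefuted_not_closed: "unrefuted h \<Sigma> \<Longrightarrow> \<not> closed_seqt \<Sigma>"
  unfolding unrefuted_def using refut.closed by blast

lemma unrefuted_not_repeated: "unrefuted h \<Sigma> \<Longrightarrow> \<Sigma> \<notin> h"
  unfolding unrefuted_def using refut.repeated by blast

context closed_set
begin

definition sfms :: "('p, 'a) sfm set" where
  "sfms = {\<theta>. unload \<theta> \<in> D}"

lemma finite_sfms: "finite sfms"
proof -
  have "sfms = (\<Union>\<phi>\<in>D. {\<theta>. unload \<theta> = \<phi>})" by (auto simp: sfms_def)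
  then show ?thesis using finite_UN_I[OF finite_D finite_unload] by simp
qed

lemma Free_in_sfms [simp]: "Free \<phi> \<in> sfms \<longleftrightarrow> \<phi> \<in> D"
  by (simp add: sfms_def)

lemma Free_image_sfms [simp]: "Free ` \<Delta> \<subseteq> sfms \<longleftrightarrow> \<Delta> \<subseteq> D"
  by auto

text \<open>If every child had a refutation, the largest height would bound them all and one more
  step would refute \<Sigma>. There are finitely many children, as they are subsets of the finite
  set \<open>sfms\<close>.\<close>

lemma unrefuted_step:
  assumes "unrefuted h \<Sigma>" "rule_inst r \<Sigma> C" "r = RLMinus \<Longrightarrow> h \<noteq> {}" "C \<noteq> {}" "\<And>c. c \<in> C \<Longrightarrow> c \<subseteq> sfms"
  obtains c where "c \<in> C" "unrefuted (hist h \<Sigma> c) c"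
proof (rule ccontr)
  assume "\<not> thesis"
  then have "\<forall>c\<in>C. \<exists>n. refut n (hist h \<Sigma> c) c" using that by (auto simp: unrefuted_def)
  then obtain f where f: "\<And>c. c \<in> C \<Longrightarrow> refut (f c) (hist h \<Sigma> c) c" by metis
  have "C \<subseteq> Pow sfms" using assms(5) by blast
  then have fin: "finite C" using finite_sfms by (meson finite_Pow_iff finite_subset)
  have "refut (Max (f ` C)) (hist h \<Sigma> c) c" if "c \<in> C" for c
    using refut_mono[OF f[OF that]] fin that by simp
  moreover have "finite c" if "c \<in> C" for c using assms(5)[OF that] finite_sfms finite_subset by blast
  ultimately have "refut (Suc (Max (f ` C))) h \<Sigma>"
    using refut.step[OF assms(2,3) fin assms(4)] by blast
  then show False using assms(1) by (auto simp: unrefuted_def)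
qed

lemma unrefuted_expand:
  assumes "unrefuted h \<Sigma>" "\<Sigma> \<subseteq> sfms" "Free \<phi> \<in> \<Sigma>" "\<not> basic_fm \<phi>"
  obtains \<Gamma> where "\<Gamma> \<in> expansions \<phi>" "\<Gamma> \<subseteq> D"
    "unrefuted (hist h \<Sigma> (\<Sigma> - {Free \<phi>} \<union> Free ` \<Gamma>)) (\<Sigma> - {Free \<phi>} \<union> Free ` \<Gamma>)"
proof -
  let ?\<Delta> = "\<Sigma> - {Free \<phi>}"
  have \<Sigma>: "\<Sigma> = insert (Free \<phi>) ?\<Delta>" using assms(3) by auto
  have \<phi>D: "\<phi> \<in> D" using assms(2,3) by auto
  obtain r where r: "r \<noteq> RLMinus" "rule_inst r \<Sigma> {?\<Delta> \<union> Free ` \<Gamma> | \<Gamma>. \<Gamma> \<in> expansions \<phi>}"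
    using expansions_rule[OF assms(4), of ?\<Delta>] \<Sigma> by auto
  have D: "\<Gamma> \<subseteq> D" if "\<Gamma> \<in> expansions \<phi>" for \<Gamma> using expansions_D[OF \<phi>D assms(4) that] .
  have "\<exists>c. c \<in> {?\<Delta> \<union> Free ` \<Gamma> | \<Gamma>. \<Gamma> \<in> expansions \<phi>} \<and> unrefuted (hist h \<Sigma> c) c"
  proof (rule unrefuted_step[OF assms(1) r(2)])
    show "{?\<Delta> \<union> Free ` \<Gamma> | \<Gamma>. \<Gamma> \<in> expansions \<phi>} \<noteq> {}" using expansions_nonempty[OF assms(4)] by blast
    show "c \<subseteq> sfms" if "c \<in> {?\<Delta> \<union> Free ` \<Gamma> | \<Gamma>. \<Gamma> \<in> expansions \<phi>}" for c
      using that assms(2) D by fastforce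
  qed (use r(1) in blast)+
  then show thesis using that D by blast
qed

section \<open>Worlds obtained from free and from loaded sequents\<close>

definition atoms :: "('p, 'a) fm set set" where
  "atoms = {B. B \<subseteq> D \<and> (\<forall>\<phi>\<in>B. basic_fm \<phi>) \<and> unrefuted {} (Free ` B)}"

text \<open>Local rules are applied until only basic formulas remain; the local weight forces this
  to end. On the way back, each expanded formula is entailed because its expansion is.\<close>

lemma free_atom:
  assumes "unrefuted {} (Free ` \<Delta>)" "\<Delta> \<subseteq> D"
  shows "\<exists>B\<in>atoms. \<forall>\<phi>\<in>\<Delta>. ent B \<phi>"
  using assms
proof (induction "sum local_weight \<Delta>" arbitrary: \<Delta> rule: less_induct)
  case less
  have fin: "finite \<Delta>" using less.prems(2) finite_D finite_subset by blast
  show ?case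
  proof (cases "\<forall>\<phi>\<in>\<Delta>. basic_fm \<phi>")
    case True
    then have "\<Delta> \<in> atoms" using less.prems by (simp add: atoms_def)
    then show ?thesis using True ent_basic by blast
  next
    case False
    then obtain \<phi> where \<phi>: "\<phi> \<in> \<Delta>" "\<not> basic_fm \<phi>" by blast
    obtain \<Gamma> where \<Gamma>: "\<Gamma> \<in> expansions \<phi>" "\<Gamma> \<subseteq> D"
      "unrefuted (hist {} (Free ` \<Delta>) (Free ` \<Delta> - {Free \<phi>} \<union> Free ` \<Gamma>)) (Free ` \<Delta> - {Free \<phi>} \<union> Free ` \<Gamma>)"
      using unrefuted_expand[OF less.prems(1) _ _ \<phi>(2)] less.prems(2) \<phi>(1) by (metis Free_image_sfms imageI)
    let ?\<Delta>' = "\<Delta> - {\<phi>} \<union> \<Gamma>"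
    have eq: "Free ` \<Delta> - {Free \<phi>} \<union> Free ` \<Gamma> = Free ` ?\<Delta>'" by auto
    have fin': "finite \<Gamma>" using \<Gamma>(2) finite_D finite_subset by blast
    have "sum local_weight ?\<Delta>' \<le> sum local_weight (\<Delta> - {\<phi>}) + sum local_weight \<Gamma>"
      using fin fin' by (intro sum_Un_le) auto
    also have "\<dots> < sum local_weight (\<Delta> - {\<phi>}) + local_weight \<phi>"
      using expansions_weight[OF \<phi>(2) \<Gamma>(1) fin'] by simp
    also have "\<dots> = sum local_weight \<Delta>" using sum.remove[OF fin \<phi>(1), of local_weight] by simp
    finally have "sum local_weight ?\<Delta>' < sum local_weight \<Delta>" .
    moreover have "unrefuted {} (Free ` ?\<Delta>')" using \<Gamma>(3) unfolding eq by (simp add: hist_def)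
    ultimately obtain B where B: "B \<in> atoms" "\<forall>\<psi>\<in>?\<Delta>'. ent B \<psi>"
      using less.hyps[of ?\<Delta>'] less.prems(2) \<Gamma>(2) by blast
    have "ent B \<phi>" using ent_expand[OF \<phi>(2) \<Gamma>(1)] B(2) by blast
    then show ?thesis using B by blast
  qed
qed

text \<open>Prover's order of play: expand the context, then unfold the loaded diamond, then apply
  (M). At a basic sequent survival is used a second time, against (L-), to see that the unloaded
  sequent is a world; this requires \<open>h \<noteq> {}\<close>.\<close>

lemma unrefuted_loaded_cases:
  fixes \<alpha> \<xi> \<Delta>
  defines "\<Sigma> \<equiv> insert (NegLBox \<alpha> \<xi>) (Free ` \<Delta>)"
  assumes "unrefuted h \<Sigma>" "\<Sigma> \<subseteq> sfms"
  obtains (Expand) \<phi> \<Gamma> \<Sigma>' where "\<phi> \<in> \<Delta>" "\<not> basic_fm \<phi>" "\<Gamma> \<in> expansions \<phi>"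
      "\<Sigma>' = insert (NegLBox \<alpha> \<xi>) (Free ` (\<Delta> - {\<phi>} \<union> \<Gamma>))" "\<Sigma>' \<subseteq> sfms" "unrefuted (hist h \<Sigma> \<Sigma>') \<Sigma>'"
  | (Unfold) Y ds \<Sigma>' where "\<not> is_atomic \<alpha>" "(Y, ds) \<in> H_dia \<alpha>"
      "\<Sigma>' = insert (neg_xi (lboxes ds \<xi>)) (Free ` (\<Delta> \<union> Y))" "\<Sigma>' \<subseteq> sfms" "unrefuted (hist h \<Sigma> \<Sigma>') \<Sigma>'"
  | (Basic) a \<Sigma>' where "\<alpha> = Atomic a" "\<forall>\<phi>\<in>\<Delta>. basic_fm \<phi>"
      "h \<noteq> {} \<Longrightarrow> insert (Neg (Box \<alpha> (unload_xi \<xi>))) \<Delta> \<in> atoms"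
      "\<Sigma>' = insert (neg_xi \<xi>) (Free ` {\<phi>. Box (Atomic a) \<phi> \<in> \<Delta>})" "\<Sigma>' \<subseteq> sfms" "unrefuted (hist h \<Sigma> \<Sigma>') \<Sigma>'"
proof -
  have D: "\<Delta> \<subseteq> D" "Neg (Box \<alpha> (unload_xi \<xi>)) \<in> D" using assms(3) by (auto simp: \<Sigma>_def sfms_def)
  have ld: "loaded \<Sigma>" by (simp add: \<Sigma>_def)
  have notin: "NegLBox \<alpha> \<xi> \<notin> Free ` \<Delta>" by auto
  consider \<phi> where "\<phi> \<in> \<Delta>" "\<not> basic_fm \<phi>" | "\<forall>\<phi>\<in>\<Delta>. basic_fm \<phi>" "\<not> is_atomic \<alpha>"
    | a where "\<forall>\<phi>\<in>\<Delta>. basic_fm \<phi>" "\<alpha> = Atomic a"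
    by (auto simp: is_atomic_def)
  then show thesis
  proof cases
    case 1
    obtain \<Gamma> where \<Gamma>: "\<Gamma> \<in> expansions \<phi>" "\<Gamma> \<subseteq> D"
      "unrefuted (hist h \<Sigma> (\<Sigma> - {Free \<phi>} \<union> Free ` \<Gamma>)) (\<Sigma> - {Free \<phi>} \<union> Free ` \<Gamma>)"
      using unrefuted_expand[OF assms(2,3) _ 1(2)] 1(1) by (metis \<Sigma>_def imageI insertCI)
    have "\<Sigma> - {Free \<phi>} \<union> Free ` \<Gamma> = insert (NegLBox \<alpha> \<xi>) (Free ` (\<Delta> - {\<phi>} \<union> \<Gamma>))"
      by (auto simp: \<Sigma>_def)
    moreover have "insert (NegLBox \<alpha> \<xi>) (Free ` (\<Delta> - {\<phi>} \<union> \<Gamma>)) \<subseteq> sfms"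
      using D \<Gamma>(2) by (auto simp: sfms_def)
    ultimately show ?thesis using Expand[OF 1 \<Gamma>(1) refl] \<Gamma>(3) by simp
  next
    case 2
    let ?C = "{Free ` \<Delta> \<union> \<Gamma> | \<Gamma>. \<Gamma> \<in> lunfold_dia \<alpha> \<xi>}"
    have r: "rule_inst RLDia \<Sigma> ?C" unfolding \<Sigma>_def using notin 2(2) by (rule rule_inst.ldia)
    have C: "\<exists>Y ds. c = insert (neg_xi (lboxes ds \<xi>)) (Free ` (\<Delta> \<union> Y)) \<and> (Y, ds) \<in> H_dia \<alpha> \<and> c \<subseteq> sfms"
      if "c \<in> ?C" for c
    proof -
      obtain Y ds where Y: "c = Free ` \<Delta> \<union> (Free ` Y \<union> {neg_xi (lboxes ds \<xi>)})" "(Y, ds) \<in> H_dia \<alpha>"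
        using \<open>c \<in> ?C\<close> by (auto simp: lunfold_dia_def)
      have "Y \<union> {Neg (boxes ds (unload_xi \<xi>))} \<in> expansions (Neg (Box \<alpha> (unload_xi \<xi>)))"
        using Y(2) by (auto simp: unfold_dia_def)
      then have "Y \<union> {Neg (boxes ds (unload_xi \<xi>))} \<subseteq> D"
        using expansions_D[OF D(2)] 2(2) basic_fm_simps(6) by blast
      then have "c \<subseteq> sfms" using D(1) unfolding Y(1) by (auto simp: sfms_def)
      then show ?thesis using Y by blast
    qed
    have "?C \<noteq> {}" using H_dia_nonempty[of \<alpha>] by (auto simp: lunfold_dia_def)
    then obtain c where c: "c \<in> ?C" "unrefuted (hist h \<Sigma> c) c"
      using unrefuted_step[OF assms(2) r] C by blast
    from C[OF c(1)] obtain Y ds where "c = insert (neg_xi (lboxes ds \<xi>)) (Free ` (\<Delta> \<union> Y))"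
      "(Y, ds) \<in> H_dia \<alpha>" "c \<subseteq> sfms" by (elim exE conjE)
    with c(2) show ?thesis using Unfold[OF 2(2)] by simp
  next
    case 3
    have b: "basic (Free ` \<Delta>)" using 3 by (auto simp: basic_def)
    let ?c = "insert (neg_xi \<xi>) (Free ` {\<phi>. Box (Atomic a) \<phi> \<in> \<Delta>})"
    have "proj a (Free ` \<Delta>) = Free ` {\<phi>. Box (Atomic a) \<phi> \<in> \<Delta>}" by (auto simp: proj_def)
    then have r: "rule_inst RModal \<Sigma> {?c}"
      unfolding \<Sigma>_def using rule_inst.modal[of a \<xi> "Free ` \<Delta>"] notin b 3(2) by simp
    have "{\<phi>. Box (Atomic a) \<phi> \<in> \<Delta>} \<subseteq> D" using D(1) Box_D by blast
    moreover have "Neg (unload_xi \<xi>) \<in> D" using Neg_Box_D D(2) 3(2) by blast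
    ultimately have c: "?c \<subseteq> sfms" by (auto simp: sfms_def)
    have u: "unrefuted (hist h \<Sigma> ?c) ?c"
      using unrefuted_step[OF assms(2) r] c by auto
    have at: "insert (Neg (Box \<alpha> (unload_xi \<xi>))) \<Delta> \<in> atoms" if h: "h \<noteq> {}"
    proof -
      let ?B = "insert (Neg (Box \<alpha> (unload_xi \<xi>))) \<Delta>"
      obtain \<alpha>s \<phi> where \<xi>: "\<xi> = lboxes \<alpha>s (Unmarked \<phi>)" using xi_lboxes by blast
      have r: "rule_inst RLMinus \<Sigma> {Free ` ?B}"
        unfolding \<Sigma>_def \<xi> using rule_inst.lminus[of \<alpha> \<alpha>s \<phi> "Free ` \<Delta>"] notin b \<xi> by simp
      have BD: "?B \<subseteq> D" using D by simp
      have "unrefuted (hist h \<Sigma> (Free ` ?B)) (Free ` ?B)"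
        using unrefuted_step[OF assms(2) r h] BD by (metis Free_image_sfms empty_not_insert singletonD)
      then have "unrefuted {} (Free ` ?B)" by (simp add: hist_def)
      then show ?thesis using BD 3 by (auto simp: atoms_def)
    qed
    show ?thesis using Basic[OF 3(2,1) at refl c u] .
  qed
qed

text \<open>Survival means that \<Sigma> is not yet in \<open>h\<close>, so recording it uses up one
  of finitely many labels.\<close>

lemma card_unvisited_less:
  assumes "unrefuted h \<Sigma>" "\<Sigma> \<subseteq> sfms"
  shows "card (Pow sfms - insert \<Sigma> h) < card (Pow sfms - h)"
  using assms unrefuted_not_repeated[OF assms(1)] finite_sfms
  by (intro psubset_card_mono) auto

text \<open>Every step from a loaded sequent adds a new label to \<open>h\<close>, hence the induction measure.\<close>

lemma xi_atom:
  fixes \<xi> \<Delta>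
  assumes "unrefuted h (insert (neg_xi \<xi>) (Free ` \<Delta>))" "insert (neg_xi \<xi>) (Free ` \<Delta>) \<subseteq> sfms"
    "loaded (insert (neg_xi \<xi>) (Free ` \<Delta>)) \<longleftrightarrow> h \<noteq> {}"
  shows "\<exists>B\<in>atoms. (\<forall>\<phi>\<in>\<Delta>. ent B \<phi>) \<and> ent B (Neg (unload_xi \<xi>))"
  using assms
proof (induction "card (Pow sfms - h)" arbitrary: h \<xi> \<Delta> rule: less_induct)
  case less
  show ?case
  proof (cases \<xi>)
    case (Unmarked \<phi>)
    have eq: "insert (neg_xi \<xi>) (Free ` \<Delta>) = Free ` insert (Neg \<phi>) \<Delta>" using Unmarked by simp
    then have "h = {}" using less.prems(3) by (metis not_loaded_Free)
    then have "\<exists>B\<in>atoms. \<forall>\<phi>\<in>insert (Neg \<phi>) \<Delta>. ent B \<phi>"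
      using free_atom less.prems(1,2) unfolding eq by (metis Free_image_sfms)
    then show ?thesis using Unmarked by auto
  next
    case (LBox \<alpha> \<xi>')
    let ?\<Sigma> = "insert (NegLBox \<alpha> \<xi>') (Free ` \<Delta>)"
    have \<Sigma>: "insert (neg_xi \<xi>) (Free ` \<Delta>) = ?\<Sigma>" using LBox by simp
    have u: "unrefuted h ?\<Sigma>" "?\<Sigma> \<subseteq> sfms" and h: "h \<noteq> {}" using less.prems \<Sigma> by auto
    \<comment> \<open>A loaded successor falls under the induction hypothesis; a free one has its
      history reset, and \<open>free_atom\<close> takes over.\<close>
    have IH: "\<exists>B\<in>atoms. (\<forall>\<phi>\<in>\<Delta>'. ent B \<phi>) \<and> ent B (Neg (unload_xi \<eta>))"
      if c: "c = insert (neg_xi \<eta>) (Free ` \<Delta>')" "c \<subseteq> sfms" "unrefuted (hist h ?\<Sigma> c) c" for c \<eta> \<Delta>'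
    proof (cases "loaded c")
      case True
      then have "hist h ?\<Sigma> c = insert ?\<Sigma> h" by (simp add: hist_def)
      then show ?thesis using less.hyps[OF card_unvisited_less[OF u], of \<eta> \<Delta>'] c True by simp
    next
      case False
      then obtain \<psi> where \<eta>: "\<eta> = Unmarked \<psi>" using c(1) by (cases \<eta>) auto
      have eq: "c = Free ` insert (Neg \<psi>) \<Delta>'" using c(1) \<eta> by simp
      have "unrefuted {} c" using c(3) False by (simp add: hist_def)
      then have "\<exists>B\<in>atoms. \<forall>\<phi>\<in>insert (Neg \<psi>) \<Delta>'. ent B \<phi>"
        using free_atom c(2) unfolding eq by (metis Free_image_sfms)
      then show ?thesis using \<eta> by auto
    qed
    from u show ?thesis
    proof (cases rule: unrefuted_loaded_cases)
      case (Expand \<phi> \<Gamma> \<Sigma>')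
      then obtain B where B: "B \<in> atoms" "\<forall>\<phi>\<in>\<Delta> - {\<phi>} \<union> \<Gamma>. ent B \<phi>" "ent B (Neg (unload_xi \<xi>))"
        using IH[of \<Sigma>' \<xi> "\<Delta> - {\<phi>} \<union> \<Gamma>"] LBox by auto
      then have "ent B \<phi>" using ent_expand[OF Expand(2,3)] by blast
      then show ?thesis using B by blast
    next
      case (Unfold Y ds \<Sigma>')
      then obtain B where B: "B \<in> atoms" "\<forall>\<phi>\<in>\<Delta> \<union> Y. ent B \<phi>" "ent B (Neg (boxes ds (unload_xi \<xi>')))"
        using IH[of \<Sigma>' "lboxes ds \<xi>'" "\<Delta> \<union> Y"] by auto
      then have "ent B (Neg (unload_xi \<xi>))" using Unfold(2) LBox ent_Neg_Box_iff by fastforce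
      then show ?thesis using B by blast
    next
      case (Basic a \<Sigma>')
      \<comment> \<open>Play can end here: (L-) turns the present sequent into a world.\<close>
      let ?B = "insert (Neg (Box \<alpha> (unload_xi \<xi>'))) \<Delta>"
      have "?B \<in> atoms" using Basic h by simp
      then show ?thesis using LBox by (intro bexI[of _ ?B]) (auto intro!: ent_basic simp: atoms_def)
    qed
  qed
qed

end

section \<open>Program lists\<close>

definition rels :: "('w, 'p, 'a) kripke \<Rightarrow> ('p, 'a) prog list \<Rightarrow> ('w \<times> 'w) set" where
  "rels M ds = foldr (\<lambda>d R. rel M d O R) ds (Id_on (worlds M))"

lemma rels_simps [simp]: "rels M [] = Id_on (worlds M)" "rels M (d # ds) = rel M d O rels M ds"
  by (auto simp: rels_def)

lemma rel_worlds:
  assumes "kripke_model M"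
  shows "rel M \<alpha> \<subseteq> worlds M \<times> worlds M"
proof (induction \<alpha> rule: prog_induct)
  case (Atomic a)
  then show ?case using assms by (simp add: kripke_model_def)
next
  case (Star \<alpha>)
  have "(w, v) \<in> (rel M \<alpha>)\<^sup>* \<Longrightarrow> w \<in> worlds M \<Longrightarrow> v \<in> worlds M" for w v
    by (induction rule: rtrancl_induct) (use Star in auto)
  then show ?case by auto
qed auto

lemma rels_append:
  assumes "kripke_model M"
  shows "rels M (ds @ es) = rels M ds O rels M es"
proof (induction ds)
  case Nil
  have "rels M es \<subseteq> worlds M \<times> UNIV"
  proof (cases es)
    case (Cons d es')
    then show ?thesis using rel_worlds[OF assms, of d] by auto
  qed auto
  then show ?case by auto
qed auto

text \<open>Soundness of diamond unfolding: each pair describes one way of running \<alpha>, with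
  the tests passed at once and the programs still to be run.\<close>

lemma H_dia_rel:
  assumes M: "kripke_model M" and "(Y, ds) \<in> H_dia \<alpha>" "\<forall>\<tau>\<in>Y. sat M w \<tau>" "(w, v) \<in> rels M ds"
  shows "(w, v) \<in> rel M \<alpha>"
  using assms(2-)
proof (induction \<alpha> arbitrary: Y ds w v rule: prog_induct)
  case (Choice \<alpha> \<beta>)
  from Choice.prems show ?case using Choice.IH(1)[of Y ds w v] Choice.IH(2)[of Y ds w v] by auto
next
  case (Seq \<alpha> \<beta>)
  from Seq.prems(1) consider bs where "ds = bs @ [\<beta>]" "(Y, bs) \<in> H_dia \<alpha>"
    | X Z where "Y = X \<union> Z" "(X, []) \<in> H_dia \<alpha>" "(Z, ds) \<in> H_dia \<beta>"
    by auto
  then show ?case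
  proof cases
    case 1
    then obtain u where "(w, u) \<in> rels M bs" "(u, v) \<in> rel M \<beta>"
      using Seq.prems(3) by (auto simp: rels_append[OF M])
    then show ?thesis using Seq.IH(1)[OF 1(2) Seq.prems(2)] by auto
  next
    case 2
    \<comment> \<open>With an empty list \<alpha> only tests and stays at \<open>w\<close>. That
      \<open>w\<close> is a world is read off from the \<beta>-step.\<close>
    have b: "(w, v) \<in> rel M \<beta>" using Seq.IH(2)[OF 2(3)] Seq.prems 2(1) by blast
    then have "(w, w) \<in> rels M []" using rel_worlds[OF M] by auto
    then have "(w, w) \<in> rel M \<alpha>" using Seq.IH(1)[OF 2(2)] Seq.prems 2(1) by blast
    then show ?thesis using b by auto
  qed
next
  case (Star \<alpha>)
  from Star.prems(1) consider "ds = []" | bs where "ds = bs @ [Star \<alpha>]" "(Y, bs) \<in> H_dia \<alpha>" by auto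
  then show ?case
  proof cases
    case 1
    then show ?thesis using Star.prems(3) by auto
  next
    case 2
    then obtain u where u: "(w, u) \<in> rels M bs" "(u, v) \<in> rel M (Star \<alpha>)"
      using Star.prems(3) by (auto simp: rels_append[OF M])
    then have wu: "(w, u) \<in> rel M \<alpha>" using Star.IH[OF 2(2) Star.prems(2)] by blast
    then have "w \<in> worlds M" using rel_worlds[OF M] by blast
    then show ?thesis using wu u(2) by (auto intro: converse_rtrancl_into_rtrancl)
  qed
qed auto

section \<open>The model\<close>

text \<open>Since models live on natural numbers, \<open>g\<close> numbers the atoms, and
  \<open>w\<close> stands for the atom \<open>g w\<close>.\<close>

locale canonical_model = closed_set D for D :: "('p, 'a) fm set" +
  fixes N :: "nat set" and g :: "nat \<Rightarrow> ('p, 'a) fm set"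
  assumes N_nonempty: "N \<noteq> {}" and g_image: "g ` N = atoms"
begin

definition M :: "(nat, 'p, 'a) kripke" where
  "M = \<lparr>worlds = N,
        acc = \<lambda>a. {(w, v). w \<in> N \<and> v \<in> N \<and> (\<forall>\<phi>. Box (Atomic a) \<phi> \<in> g w \<longrightarrow> ent (g v) \<phi>)},
        val = \<lambda>p. {w \<in> N. Prop p \<in> g w}\<rparr>"

lemma M_simps [simp]:
  "worlds M = N" "(w, v) \<in> acc M a \<longleftrightarrow> w \<in> N \<and> v \<in> N \<and> (\<forall>\<phi>. Box (Atomic a) \<phi> \<in> g w \<longrightarrow> ent (g v) \<phi>)"
  "w \<in> val M p \<longleftrightarrow> w \<in> N \<and> Prop p \<in> g w"
  by (auto simp: M_def)

lemma kripke_M: "kripke_model M"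
  using N_nonempty by (auto simp: kripke_model_def)

lemma g_atom: "w \<in> N \<Longrightarrow> g w \<in> atoms"
  by (simp add: g_image[symmetric])

lemma atom_g: "B \<in> atoms \<Longrightarrow> \<exists>w\<in>N. g w = B"
  by (auto simp: g_image[symmetric])

lemma g_not_closed: "w \<in> N \<Longrightarrow> \<not> closed_seqt (Free ` g w)"
  using g_atom[of w] unrefuted_not_closed[of "{}" "Free ` g w"] by (simp add: atoms_def)

text \<open>Tests outside \<open>l\<close> have their negations entailed and hence fail at
  \<open>w\<close>, so any run of \<alpha> passes only tests that \<open>P_box l\<close> takes into
  account. The first assumption will come from the induction hypothesis of
  \<open>truth\<close>.\<close>

lemma ent_box_step:
  assumes "\<And>\<tau> w. \<lbrakk>\<tau> \<in> Tests \<alpha>; w \<in> N; ent (g w) (Neg \<tau>)\<rbrakk> \<Longrightarrow> \<not> sat M w \<tau>"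
    and "ent (g w) (Box \<alpha> \<phi>)" "(w, v) \<in> rel M \<alpha>"
  shows "ent (g v) \<phi>"
proof -
  have "ent (g v) \<phi>"
    if "\<forall>\<tau>\<in>Tests \<alpha> - l. ent (g w) (Neg \<tau>)" "\<forall>ds\<in>P_box l \<alpha>. ent (g w) (boxes ds \<phi>)" "(w, v) \<in> rel M \<alpha>" for l
    using that assms(1)
  proof (induction \<alpha> arbitrary: w v \<phi> l rule: prog_induct)
    case (Atomic a)
    then show ?case by (auto simp: ent_basic_iff)
  next
    case (Test \<tau>)
    then have "w \<in> N" "v = w" "sat M w \<tau>" by auto
    \<comment> \<open>Otherwise \<open>Neg \<tau>\<close> would be entailed at \<open>w\<close>, and
      the test would fail there.\<close>
    moreover have "\<tau> \<in> l" using Test calculation by auto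
    ultimately show ?case using Test.prems(2) by simp
  next
    case (Choice \<alpha> \<beta>)
    from Choice.prems(3) have "(w, v) \<in> rel M \<alpha> \<or> (w, v) \<in> rel M \<beta>" by simp
    then show ?case
    proof
      assume "(w, v) \<in> rel M \<alpha>"
      then show ?thesis using Choice.prems by (intro Choice.IH(1)[of l w \<phi> v]) auto
    next
      assume "(w, v) \<in> rel M \<beta>"
      then show ?thesis using Choice.prems by (intro Choice.IH(2)[of l w \<phi> v]) auto
    qed
  next
    case (Seq \<alpha> \<beta>)
    from Seq.prems(3) obtain u where u: "(w, u) \<in> rel M \<alpha>" "(u, v) \<in> rel M \<beta>" by auto
    \<comment> \<open>The same \<open>l\<close> serves for \<alpha> with body
      \<open>[\<beta>]\<phi>\<close>. For the empty list this body must hold at \<open>w\<close>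
      itself, and it does because the unfolding of \<beta> is then included.\<close>
    have "ent (g w) (boxes ds (Box \<beta> \<phi>))" if "ds \<in> P_box l \<alpha>" for ds
    proof (cases "ds = []")
      case True
      then have "\<forall>cs\<in>P_box l \<beta>. ent (g w) (boxes cs \<phi>)" using Seq.prems(2) that by auto
      moreover have "\<forall>\<tau>\<in>Tests \<beta> - l. ent (g w) (Neg \<tau>)" using Seq.prems(1) by auto
      ultimately show ?thesis using True by (auto simp: ent_Box_iff)
    next
      case False
      then have "ds @ [\<beta>] \<in> P_box l (Seq \<alpha> \<beta>)" using that by auto
      then show ?thesis using Seq.prems(2) by fastforce
    qed
    then have "ent (g u) (Box \<beta> \<phi>)"
      using u(1) Seq.prems(1,4) by (intro Seq.IH(1)[of l w "Box \<beta> \<phi>" u]) auto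
    \<comment> \<open>At the intermediate world \<open>[\<beta>]\<phi>\<close> is unfolded afresh,
      with its own set of tests.\<close>
    then obtain l' where "\<forall>\<tau>\<in>Tests \<beta> - l'. ent (g u) (Neg \<tau>)" "\<forall>ds\<in>P_box l' \<beta>. ent (g u) (boxes ds \<phi>)"
      unfolding ent_Box_iff by blast
    then show ?case using u(2) Seq.prems(4) by (intro Seq.IH(2)[of l' u \<phi> v]) auto
  next
    case (Star \<alpha>)
    \<comment> \<open>The whole box over the iteration is the invariant along
      \<alpha>-steps.\<close>
    have step: "ent (g y) (Box (Star \<alpha>) \<phi>)" if x: "ent (g x) (Box (Star \<alpha>) \<phi>)" and xy: "(x, y) \<in> rel M \<alpha>" for x y
    proof -
      obtain l' where l': "\<forall>\<tau>\<in>Tests \<alpha> - l'. ent (g x) (Neg \<tau>)"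
        "\<forall>ds\<in>P_box l' (Star \<alpha>). ent (g x) (boxes ds \<phi>)"
        using x unfolding ent_Box_iff by auto
      have "ent (g x) (boxes ds (Box (Star \<alpha>) \<phi>))" if "ds \<in> P_box l' \<alpha>" for ds
      proof (cases "ds = []")
        case False
        then have "ds @ [Star \<alpha>] \<in> P_box l' (Star \<alpha>)" using that by auto
        then show ?thesis using l'(2) by fastforce
      qed (use x in simp)
      then show ?thesis using l'(1) xy Star.prems(4) by (intro Star.IH[of l' x _ y]) auto
    qed
    have w: "ent (g w) (Box (Star \<alpha>) \<phi>)" using Star.prems(1,2) unfolding ent_Box_iff by blast
    have "(w, v) \<in> (rel M \<alpha>)\<^sup>*" using Star.prems(3) by simp
    then have "ent (g v) (Box (Star \<alpha>) \<phi>)"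
      by (induction rule: rtrancl_induct) (use w step in auto)
    \<comment> \<open>The empty list, always present for an iteration, gives \<phi> itself.\<close>
    then obtain l' where "\<forall>ds\<in>P_box l' (Star \<alpha>). ent (g v) (boxes ds \<phi>)" unfolding ent_Box_iff by blast
    then show ?case by fastforce
  qed
  then show ?thesis using assms(2,3) unfolding ent_Box_iff by blast
qed

text \<open>Follows Prover's play until the boxes \<gamma>s are used up, assembling a path from the
  worlds that (L-) yields on the way. The remainder \<xi> may still be loaded. The assumption on
  tests is again for the induction hypothesis of \<open>truth\<close>.\<close>

lemma loaded_path:
  assumes "\<And>\<gamma> \<tau> w. \<lbrakk>\<gamma> \<in> set \<gamma>s; \<tau> \<in> Tests \<gamma>; w \<in> N; ent (g w) \<tau>\<rbrakk> \<Longrightarrow> sat M w \<tau>"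
    and "\<Sigma> = insert (neg_xi (lboxes \<gamma>s \<xi>)) (Free ` \<Delta>)" "unrefuted h \<Sigma>" "\<Sigma> \<subseteq> sfms" "loaded \<Sigma> \<longleftrightarrow> h \<noteq> {}"
  shows "\<exists>w\<in>N. (\<forall>\<phi>\<in>\<Delta>. ent (g w) \<phi>) \<and> ent (g w) (Neg (boxes \<gamma>s (unload_xi \<xi>))) \<and>
    (\<exists>v\<in>N. (w, v) \<in> rels M \<gamma>s \<and> ent (g v) (Neg (unload_xi \<xi>)))" (is "?P \<gamma>s \<Delta>")
  using assms
proof (induction "card (Pow sfms - h)" arbitrary: h \<gamma>s \<Delta> \<Sigma> rule: less_induct)
  case less
  \<comment> \<open>Once \<gamma>s is exhausted the path ends, and \<open>xi_atom\<close> provides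
    its last world even if \<xi> is loaded.\<close>
  have Nil: "?P [] \<Delta>'"
    if c: "c = insert (neg_xi \<xi>) (Free ` \<Delta>')" "unrefuted h' c" "c \<subseteq> sfms" "loaded c \<longleftrightarrow> h' \<noteq> {}" for c h' \<Delta>'
  proof -
    obtain B where "B \<in> atoms" "\<forall>\<phi>\<in>\<Delta>'. ent B \<phi>" "ent B (Neg (unload_xi \<xi>))"
      using xi_atom[of h' \<xi> \<Delta>'] c by auto
    then show ?thesis using atom_g by fastforce
  qed
  show ?case
  proof (cases \<gamma>s)
    case \<gamma>s: Nil
    then show ?thesis using Nil[of \<Sigma> \<Delta> h] less.prems by simp
  next
    case (Cons \<gamma> \<gamma>s')
    let ?\<xi> = "lboxes \<gamma>s' \<xi>"
    have \<Sigma>: "\<Sigma> = insert (NegLBox \<gamma> ?\<xi>) (Free ` \<Delta>)" using less.prems(2) Cons by simp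
    then have ld: "loaded \<Sigma>" and h: "h \<noteq> {}" using less.prems(5) by auto
    have IH: "?P \<delta>s \<Delta>'"
      if c: "c = insert (neg_xi (lboxes \<delta>s \<xi>)) (Free ` \<Delta>')" "c \<subseteq> sfms" "unrefuted (hist h \<Sigma> c) c"
        and tests: "\<And>\<delta> \<tau>. \<delta> \<in> set \<delta>s \<Longrightarrow> \<tau> \<in> Tests \<delta> \<Longrightarrow> \<exists>\<gamma>\<in>set \<gamma>s. \<tau> \<in> Tests \<gamma>" for c \<delta>s \<Delta>'
    proof (cases "loaded c")
      case True
      then have hi: "hist h \<Sigma> c = insert \<Sigma> h" using ld by (simp add: hist_def)
      show ?thesis
      proof (rule less.hyps[OF card_unvisited_less[OF less.prems(3,4)] _ c(1)])
        show "sat M w \<tau>" if "\<delta> \<in> set \<delta>s" "\<tau> \<in> Tests \<delta>" "w \<in> N" "ent (g w) \<tau>" for \<delta> \<tau> w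
          using tests[OF that(1,2)] less.prems(1) that(3,4) by blast
      qed (use c hi True in auto)
    next
      case False
      \<comment> \<open>Any remaining program would be a marked box and keep the sequent
        loaded.\<close>
      then have "\<delta>s = []" using c(1) by (cases \<delta>s) auto
      moreover have "hist h \<Sigma> c = {}" using False by (simp add: hist_def)
      ultimately show ?thesis using Nil[of c \<Delta>' "{}"] c False by simp
    qed
    from less.prems(3,4) show ?thesis
      unfolding \<Sigma>
    proof (cases rule: unrefuted_loaded_cases)
      case (Expand \<phi> \<Gamma> \<Sigma>')
      then have "?P \<gamma>s (\<Delta> - {\<phi>} \<union> \<Gamma>)" using IH[of \<Sigma>' \<gamma>s "\<Delta> - {\<phi>} \<union> \<Gamma>"] Cons \<Sigma> by auto
      then obtain w where w: "w \<in> N" "\<forall>\<psi>\<in>\<Delta> - {\<phi>} \<union> \<Gamma>. ent (g w) \<psi>"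
        "ent (g w) (Neg (boxes \<gamma>s (unload_xi \<xi>)))"
        "\<exists>v\<in>N. (w, v) \<in> rels M \<gamma>s \<and> ent (g v) (Neg (unload_xi \<xi>))"
        by blast
      then have "ent (g w) \<phi>" using ent_expand[OF Expand(2,3)] by blast
      then show ?thesis using w by blast
    next
      case (Unfold Y ds \<Sigma>')
      have "?P (ds @ \<gamma>s') (\<Delta> \<union> Y)"
      proof (rule IH[of \<Sigma>'])
        show "\<exists>\<gamma>\<in>set \<gamma>s. \<tau> \<in> Tests \<gamma>" if "\<delta> \<in> set (ds @ \<gamma>s')" "\<tau> \<in> Tests \<delta>" for \<delta> \<tau>
          using that H_dia_Tests_list[OF Unfold(2)] Cons by auto
      qed (use Unfold \<Sigma> in auto)
      then obtain w v where w: "w \<in> N" "\<forall>\<psi>\<in>\<Delta> \<union> Y. ent (g w) \<psi>"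
        "ent (g w) (Neg (boxes ds (boxes \<gamma>s' (unload_xi \<xi>))))"
        and v: "v \<in> N" "(w, v) \<in> rels M ds O rels M \<gamma>s'" "ent (g v) (Neg (unload_xi \<xi>))"
        by (auto simp: rels_append[OF kripke_M])
      have "\<forall>\<tau>\<in>Y. sat M w \<tau>"
        using less.prems(1)[of \<gamma> _ w] H_dia_Tests[OF Unfold(2)] w Cons by auto
      \<comment> \<open>The tests in \<open>Y\<close> hold at \<open>w\<close>, so every run of
        \<open>ds\<close> from \<open>w\<close> is a run of \<gamma>.\<close>
      then have "rels M ds `` {w} \<subseteq> rel M \<gamma> `` {w}" using H_dia_rel[OF kripke_M Unfold(2)] by blast
      then have "(w, v) \<in> rels M \<gamma>s" using v(2) Cons by auto
      moreover have "ent (g w) (Neg (boxes \<gamma>s (unload_xi \<xi>)))"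
        unfolding Cons boxes.simps ent_Neg_Box_iff using Unfold(2) w by blast
      ultimately show ?thesis using w v by blast
    next
      case (Basic a \<Sigma>')
      have "?P \<gamma>s' {\<phi>. Box (Atomic a) \<phi> \<in> \<Delta>}"
        using Basic \<Sigma> Cons by (intro IH[of \<Sigma>']) auto
      then obtain u v where u: "u \<in> N" "\<forall>\<phi>. Box (Atomic a) \<phi> \<in> \<Delta> \<longrightarrow> ent (g u) \<phi>"
        and v: "v \<in> N" "(u, v) \<in> rels M \<gamma>s'" "ent (g v) (Neg (unload_xi \<xi>))"
        by auto
      \<comment> \<open>This world results from (L-). Beyond \<Delta> it contains only a negated
        formula, so its boxes are those of \<Delta>, whose bodies \<open>u\<close> entails.\<close>
      obtain w where w: "w \<in> N" "g w = insert (Neg (Box \<gamma> (unload_xi ?\<xi>))) \<Delta>"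
        using atom_g[OF Basic(3)[OF h]] by blast
      have "(w, u) \<in> rel M \<gamma>" using u w Basic(1) by simp
      then have "(w, v) \<in> rels M \<gamma>s" using v(2) Cons by auto
      moreover have "\<forall>\<phi>\<in>\<Delta>. ent (g w) \<phi>" using w(2) Basic(2) by (auto intro: ent_basic)
      moreover have "ent (g w) (Neg (boxes \<gamma>s (unload_xi \<xi>)))"
        using w(2) Basic(1) Cons by (auto intro: ent_basic)
      ultimately show ?thesis using w(1) v by blast
    qed
  qed
qed

text \<open>Unfold the diamond at \<open>w\<close>. Either \<open>w\<close> is already the witness,
  or an atomic diamond belongs to \<open>g w\<close>; Prover then loads it and
  \<open>loaded_path\<close> supplies the rest.\<close>

lemma ent_diamond_step:
  assumes tests: "\<And>\<tau> w. \<lbrakk>\<tau> \<in> Tests \<alpha>; w \<in> N; ent (g w) \<tau>\<rbrakk> \<Longrightarrow> sat M w \<tau>"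
    and w: "w \<in> N" "ent (g w) (Neg (Box \<alpha> \<phi>))"
  shows "\<exists>v\<in>N. (w, v) \<in> rel M \<alpha> \<and> ent (g v) (Neg \<phi>)"
proof -
  obtain Y ds where Y: "(Y, ds) \<in> H_dia \<alpha>" "\<forall>\<tau>\<in>Y. ent (g w) \<tau>" "ent (g w) (Neg (boxes ds \<phi>))"
    using w(2) unfolding ent_Neg_Box_iff by blast
  have "\<forall>\<tau>\<in>Y. sat M w \<tau>" using Y(2) tests w(1) H_dia_Tests[OF Y(1)] by blast
  note rel = H_dia_rel[OF kripke_M Y(1) this]
  consider "ds = []" | a es where "ds = Atomic a # es" using H_dia_head[OF Y(1)] by blast
  then show ?thesis
  proof cases
    case 1
    then have "(w, w) \<in> rel M \<alpha>" using rel w(1) by auto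
    then show ?thesis using 1 Y(3) w(1) by auto
  next
    case 2
    \<comment> \<open>(L+) must also load the boxes in front of \<phi>. These \<beta>s form the
      loaded remainder and are not traversed by the path.\<close>
    obtain \<beta>s \<chi> where \<phi>: "\<phi> = boxes \<beta>s \<chi>" "\<not> is_box \<chi>" using fm_boxes by blast
    let ?\<phi> = "Neg (Box (Atomic a) (boxes (es @ \<beta>s) \<chi>))"
    let ?\<xi> = "lboxes (es @ \<beta>s) (Unmarked \<chi>)"
    let ?\<Delta> = "g w - {?\<phi>}"
    let ?\<Sigma> = "insert (NegLBox (Atomic a) ?\<xi>) (Free ` ?\<Delta>)"
    have at: "g w \<in> atoms" using g_atom[OF w(1)] .
    have mem: "?\<phi> \<in> g w" using Y(3) 2 \<phi>(1) by (simp add: ent_basic_iff)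
    then have gw: "Free ` g w = insert (Free ?\<phi>) (Free ` ?\<Delta>)" by auto
    have D: "g w \<subseteq> D" using at by (simp add: atoms_def)
    have sub: "?\<Sigma> \<subseteq> sfms" using D mem by (auto simp: sfms_def)
    have r: "rule_inst RLPlus (Free ` g w) {?\<Sigma>}"
      unfolding gw using at \<phi>(2) by (intro rule_inst.lplus) (auto simp: basic_def atoms_def)
    have "unrefuted {} (Free ` g w)" using at by (simp add: atoms_def)
    then have "unrefuted (hist {} (Free ` g w) ?\<Sigma>) ?\<Sigma>"
      by (rule unrefuted_step[OF _ r]) (use sub in auto)
    then have "unrefuted {} ?\<Sigma>" by (simp add: hist_def)
    from this sub show ?thesis
    proof (cases rule: unrefuted_loaded_cases)
      case (Expand \<psi> \<Gamma> \<Sigma>')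
      then show ?thesis using at by (auto simp: atoms_def)
    next
      case (Basic b \<Sigma>')
      then have b: "b = a" by simp
      have tests': "sat M u \<tau>" if "\<gamma> \<in> set es" "\<tau> \<in> Tests \<gamma>" "u \<in> N" "ent (g u) \<tau>" for \<gamma> \<tau> u
        using tests that H_dia_Tests_list[OF Y(1)] 2 by (metis list.set_intros(2) subsetD)
      have \<Sigma>': "\<Sigma>' = insert (neg_xi (lboxes es (lboxes \<beta>s (Unmarked \<chi>)))) (Free ` {\<phi>. Box (Atomic a) \<phi> \<in> ?\<Delta>})"
        using Basic(4) b by simp
      \<comment> \<open>After one application of (M) the history contains the sequent produced by
        (L+), so (L-) is permitted from here on.\<close>
      have h: "loaded \<Sigma>' \<longleftrightarrow> hist {} ?\<Sigma> \<Sigma>' \<noteq> {}" by (simp add: hist_def)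
      have "\<exists>u\<in>N. (\<forall>\<phi>\<in>{\<phi>. Box (Atomic a) \<phi> \<in> ?\<Delta>}. ent (g u) \<phi>) \<and>
        ent (g u) (Neg (boxes es (unload_xi (lboxes \<beta>s (Unmarked \<chi>))))) \<and>
        (\<exists>v\<in>N. (u, v) \<in> rels M es \<and> ent (g v) (Neg (unload_xi (lboxes \<beta>s (Unmarked \<chi>)))))"
        by (rule loaded_path[OF _ \<Sigma>' Basic(6,5) h]) (rule tests')
      then obtain u v where u: "u \<in> N" "\<forall>\<phi>\<in>{\<phi>. Box (Atomic a) \<phi> \<in> ?\<Delta>}. ent (g u) \<phi>"
        and v: "v \<in> N" "(u, v) \<in> rels M es" "ent (g v) (Neg \<phi>)"
        using \<phi>(1) by auto
      \<comment> \<open>Removing the negated formula from \<open>g w\<close> removed no box.\<close>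
      have "(w, u) \<in> rel M (Atomic a)" using u w(1) by auto
      then have "(w, v) \<in> rels M ds" using v(2) 2 by auto
      then show ?thesis using rel v by blast
    qed simp
  qed
qed

text \<open>An atom need not entail a formula or its negation, so the two implications are proved
  side by side. The second statement passes them to the tests, as both step lemmas require.\<close>

lemma truth:
  fixes \<phi> :: "('p, 'a) fm" and \<alpha> :: "('p, 'a) prog"
  shows "\<forall>w\<in>N. (ent (g w) \<phi> \<longrightarrow> sat M w \<phi>) \<and> (ent (g w) (Neg \<phi>) \<longrightarrow> \<not> sat M w \<phi>)"
    and "\<forall>\<tau>\<in>Tests \<alpha>. \<forall>w\<in>N. (ent (g w) \<tau> \<longrightarrow> sat M w \<tau>) \<and> (ent (g w) (Neg \<tau>) \<longrightarrow> \<not> sat M w \<tau>)"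
proof (induction \<phi> and \<alpha> rule: fm.induct prog.induct)
  case Bot
  then show ?case using g_not_closed by (auto simp: ent_basic_iff closed_seqt_def)
next
  case (Prop p)
  have "\<not> (Prop p \<in> g w \<and> Neg (Prop p) \<in> g w)" if "w \<in> N" for w
    using g_not_closed[OF that] unfolding closed_seqt_def by blast
  then show ?case by (auto simp: ent_basic_iff)
next
  case (Neg \<phi>)
  then show ?case by (auto simp: ent_nonbasic_iff[of "Neg (Neg \<phi>)"])
next
  case (Conj \<phi> \<psi>)
  then show ?case
    by (auto simp: ent_nonbasic_iff[of "Conj \<phi> \<psi>"] ent_nonbasic_iff[of "Neg (Conj \<phi> \<psi>)"])
next
  case (Box \<alpha> \<phi>)
  have "sat M w (Box \<alpha> \<phi>)" if "w \<in> N" "ent (g w) (Box \<alpha> \<phi>)" for w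
  proof -
    have "sat M v \<phi>" if v: "(w, v) \<in> rel M \<alpha>" for v
    proof -
      have "ent (g v) \<phi>" using ent_box_step[OF _ \<open>ent (g w) (Box \<alpha> \<phi>)\<close> v] Box(1) by blast
      moreover have "v \<in> N" using rel_worlds[OF kripke_M] v by fastforce
      ultimately show ?thesis using Box(2) by blast
    qed
    then show ?thesis by simp
  qed
  moreover have "\<not> sat M w (Box \<alpha> \<phi>)" if "w \<in> N" "ent (g w) (Neg (Box \<alpha> \<phi>))" for w
  proof -
    have "\<exists>v\<in>N. (w, v) \<in> rel M \<alpha> \<and> ent (g v) (Neg \<phi>)"
      using ent_diamond_step[OF _ that] Box(1) by blast
    then show ?thesis using Box(2) by auto
  qed
  ultimately show ?case by blast
qed auto

end

theorem theorem6p1: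
  fixes \<Gamma> :: "('p, 'a) fm set"
  assumes "finite \<Gamma>" and "consistent \<Gamma>"
  shows "satisfiable \<Gamma>"
proof -
  define C where "C = (\<Union>\<phi>\<in>\<Gamma>. fl \<phi>)"
  interpret closed_set "C \<union> Neg ` C" unfolding C_def using closed_set_fl[OF assms(1)] .
  have "\<not> refut n {} (Free ` \<Gamma>)" for n
    using refut_closed_tableau[of n "Free ` \<Gamma>"] assms by (auto simp: consistent_def)
  then have "unrefuted {} (Free ` \<Gamma>)" by (simp add: unrefuted_def)
  moreover have "\<Gamma> \<subseteq> C \<union> Neg ` C" by (auto simp: C_def intro: fl_refl)
  ultimately obtain B where B: "B \<in> atoms" "\<forall>\<phi>\<in>\<Gamma>. ent B \<phi>" using free_atom by blast
  have "atoms \<subseteq> Pow (C \<union> Neg ` C)" by (auto simp: atoms_def)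
  then have fin: "finite atoms" using finite_D by (meson finite_Pow_iff finite_subset)
  \<comment> \<open>The atoms are subsets of a finite set, so an initial segment of the naturals
    enumerates them; it is nonempty because \<open>B\<close> is an atom.\<close>
  obtain n :: nat and g where g: "atoms = g ` {i. i < n}"
    using finite_imp_nat_seg_image_inj_on[OF fin] by blast
  interpret canonical_model "C \<union> Neg ` C" "{i. i < n}" g
  proof
    show "{i. i < n} \<noteq> {}" using g B(1) by blast
    show "g ` {i. i < n} = atoms" by (rule g[symmetric])
  qed
  obtain w where "w \<in> {i. i < n}" "g w = B" using atom_g[OF B(1)] by blast
  then have "w \<in> worlds M" "\<forall>\<phi>\<in>\<Gamma>. sat M w \<phi>" using B(2) truth(1) by auto
  then show ?thesis unfolding satisfiable_def using kripke_M by blast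
qed

end
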